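(* Up to a constant multiplicative factor, the continuous limit of the cluster (pre)symplectic form on 2-friezes is the Adler–Gelfand–Dikii symplectic form on the moduli space of closed convex projective curves. Both objects are defined in the context below.
   Context: **2-friezes and the cluster form.** A 2-frieze is an array of numbers satisfying the local rules $E=AD-BC$ and $D=EH-FG$ for every configuration $$\begin{array}{cccc} &B&F&\\ A&E&D&H\\ &C&G&\end{array}$$ Choose as cluster coordinates the entries $x_i$ and $y_i$ of two adjacent South-East diagonals. The cluster (pre)symplectic form is $$\omega=\sum_i\Big(\frac{dx_{i+1}\wedge dx_i}{x_ix_{i+1}}+\frac{dy_{i+1}\wedge dy_i}{y_iy_{i+1}}+\frac{dx_i\wedge dy_i}{x_iy_i}+\frac{dy_i\wedge dx_{i+1}}{x_{i+1}y_i}\Big).$$ **Continuous 2-friezes.** A closed continuous 2-frieze of period $T$ is a pair of smooth functions $(F,G)$ with the following properties. - $G=FF_{xy}-F_xF_y$ and $F=GG_{xy}-G_xG_y$. - $F(x,x)=F_x(x,x)=F_y(x,x)=0$, $F_{xx}(x,x)=F_{yy}(x,x)=1$, $F_{xy}(x,x)=-1$. - $F$ is $T$-periodic in each variable. - The same conditions hold for $G$. Such pairs are exactly $F(x,y)=\det(\Gamma(x),\Gamma(y),\Gamma'(y))$ and $G(x,y)=F(y,x)$, where $\Gamma:\mathbb{R}\to\mathbb{R}^3$ is $T$-periodic with $\det(\Gamma,\Gamma',\Gamma'')=1$ and is the lift of a closed convex projective curve $\gamma\subset\mathbb{RP}^2$ (curves taken modulo $SL_3(\mathbb{R})$). **Continuous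 limit.** The continuous limit of $\omega$ is obtained as follows. 1. Substitute $x_i\mapsto F(x-\varepsilon,y-\varepsilon)$, $x_{i+1}\mapsto F(x+\varepsilon,y-\varepsilon)$, $y_i\mapsto G(x,y)$, $y_{i+1}\mapsto G(x+2\varepsilon,y)$. Here $d$ denotes variation under infinitesimal deformations of the curve. 2. Expand in $\varepsilon$. The constant term vanishes. 3. Keep the coefficient of $\varepsilon$, take $y=0$, and replace the sum by $\int_0^T\cdots\,dx$. **Adler–Gelfand–Dikii form.** Tangent vectors at $\gamma$ are vector fields $u=(u_1,u_2,u_3)$ along $\Gamma$ with $u(0)=u'(0)=u''(0)=0$; $u(\Phi)$ denotes the derivative of a quantity $\Phi$ along $u$. Let $y_1,y_2$ be the first two components of $\Gamma$ and $W=y_1y_2'-y_1'y_2$. Set - $a_1=-y_1'/y_1$, - $a_2=y_1'/y_1-W'/W$, - $A=\begin{pmatrix}2&1\\1&2\end{pmatrix}$. The form is $$\omega_{AGD}(u,v)=\int_{S^1}\big(d^{-1}u(a_1),d^{-1}u(a_2)\big)\,A\,\big(v(a_1),v(a_2)\big)^T dx.$$ Under the normalization $\Gamma(0)=(0,0,1)$, $\Gamma'(0)=(0,-1,0)$, $\Gamma''(0)=(1,0,0)$ one has $y_1=F(x,0)$ and $W=G(x,0)$. *)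

theory Defs
  imports "HOL-Analysis.Analysis"
begin

section \<open>Variations and the cluster form\<close>

text \<open>
  Points of the deformed spaces are functions \<open>p :: 'i \<Rightarrow> 'a\<close> (curves, or arrays of cluster
  coordinates); a quantity is a real function of the point. \<open>variation q p u\<close> is the derivative
  \<open>u(q)\<close> of \<open>q\<close> at \<open>p\<close> along \<open>u\<close>, in other words the differential \<open>dq\<close> at \<open>p\<close> applied to \<open>u\<close>.
\<close>

definition variation ::
  "(('i \<Rightarrow> 'a::real_vector) \<Rightarrow> real) \<Rightarrow> ('i \<Rightarrow> 'a) \<Rightarrow> ('i \<Rightarrow> 'a) \<Rightarrow> real" where
  "variation q p u = deriv (\<lambda>t. q (\<lambda>s. p s + t *\<^sub>R u s)) 0"

definition wedge ::
  "(('i \<Rightarrow> 'a::real_vector) \<Rightarrow> real) \<Rightarrow> (('i \<Rightarrow> 'a) \<Rightarrow> real) \<Rightarrow>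
   ('i \<Rightarrow> 'a) \<Rightarrow> ('i \<Rightarrow> 'a) \<Rightarrow> ('i \<Rightarrow> 'a) \<Rightarrow> real" where
  "wedge q r p u v =
     variation q p u * variation r p v - variation q p v * variation r p u"

text \<open>The summand of the cluster form, with \<open>X, X', Y, Y'\<close> in the places of
  \<open>x\<^sub>i, x\<^sub>i\<^sub>+\<^sub>1, y\<^sub>i, y\<^sub>i\<^sub>+\<^sub>1\<close>.\<close>

definition cluster_summand ::
  "(('i \<Rightarrow> 'a::real_vector) \<Rightarrow> real) \<Rightarrow> (('i \<Rightarrow> 'a) \<Rightarrow> real) \<Rightarrow>
   (('i \<Rightarrow> 'a) \<Rightarrow> real) \<Rightarrow> (('i \<Rightarrow> 'a) \<Rightarrow> real) \<Rightarrow>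
   ('i \<Rightarrow> 'a) \<Rightarrow> ('i \<Rightarrow> 'a) \<Rightarrow> ('i \<Rightarrow> 'a) \<Rightarrow> real" where
  "cluster_summand X X' Y Y' p u v =
     wedge X' X p u v / (X p * X' p)
   + wedge Y' Y p u v / (Y' p * Y p)
   + wedge X Y p u v / (X p * Y p)
   + wedge Y X' p u v / (X' p * Y p)"

text \<open>
  The discrete form, in the coordinates \<open>p i = (x\<^sub>i, y\<^sub>i)\<close> and for a finite range \<open>I\<close> of the
  summation index. Its continuous limit, below, is taken summand by summand.
\<close>

definition cluster_form ::
  "nat set \<Rightarrow> (nat \<Rightarrow> real \<times> real) \<Rightarrow> (nat \<Rightarrow> real \<times> real) \<Rightarrow> (nat \<Rightarrow> real \<times> real) \<Rightarrow> real" where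
  "cluster_form I p u v =
     (\<Sum>i\<in>I. cluster_summand (\<lambda>p. fst (p i)) (\<lambda>p. fst (p (Suc i)))
                            (\<lambda>p. snd (p i)) (\<lambda>p. snd (p (Suc i))) p u v)"

section \<open>Closed convex projective curves\<close>

definition vderiv :: "nat \<Rightarrow> (real \<Rightarrow> real^3) \<Rightarrow> real \<Rightarrow> real^3" where
  "vderiv n f = ((\<lambda>g x. vector_derivative g (at x)) ^^ n) f"

definition smooth_curve :: "(real \<Rightarrow> real^3) \<Rightarrow> bool" where
  "smooth_curve f \<longleftrightarrow> (\<forall>n x. vderiv n f differentiable (at x))"

definition det3 :: "real^3 \<Rightarrow> real^3 \<Rightarrow> real^3 \<Rightarrow> real" where
  "det3 a b c = det (vector [a, b, c] :: real^3^3)"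

text \<open>
  \<open>\<Gamma>\<close> is the periodic lift, normalised by \<open>det (\<Gamma>, \<Gamma>', \<Gamma>'') = 1\<close>, of a closed convex curve:
  every projective line, given by a nonzero normal vector \<open>l\<close>, meets the projected curve for at
  most two values of the parameter in one period. Counting parameters and not image points
  excludes multiply traversed curves.
\<close>

definition closed_convex_lift :: "real \<Rightarrow> (real \<Rightarrow> real^3) \<Rightarrow> bool" where
  "closed_convex_lift T \<Gamma> \<longleftrightarrow>
     T > 0 \<and> smooth_curve \<Gamma> \<and> (\<forall>x. \<Gamma> (x + T) = \<Gamma> x)
   \<and> (\<forall>x. det3 (\<Gamma> x) (vderiv 1 \<Gamma> x) (vderiv 2 \<Gamma> x) = 1)
   \<and> (\<forall>l. l \<noteq> 0 \<longrightarrow>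
        finite {x \<in> {0..<T}. l \<bullet> \<Gamma> x = 0} \<and> card {x \<in> {0..<T}. l \<bullet> \<Gamma> x = 0} \<le> 2)"

text \<open>
  Each \<open>SL\<^sub>3\<close>-orbit of such lifts has exactly one member with the following 2-jet at 0, so the
  normalised lifts are the points of the moduli space.
\<close>

definition normalized_lift :: "(real \<Rightarrow> real^3) \<Rightarrow> bool" where
  "normalized_lift \<Gamma> \<longleftrightarrow>
     \<Gamma> 0 = vector [0, 0, 1] \<and> vderiv 1 \<Gamma> 0 = vector [0, -1, 0] \<and> vderiv 2 \<Gamma> 0 = vector [1, 0, 0]"

text \<open>
  Smooth periodic vector fields along the curve that fix its 2-jet at 0. The tangent space of the
  moduli space consists of those which also satisfy the linearisation of
  \<open>det (\<Gamma>, \<Gamma>', \<Gamma>'') = 1\<close>. This equation is not imposed, so what is stated for all tangent fields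
  holds in particular on the tangent space.
\<close>

definition tangent_field :: "real \<Rightarrow> (real \<Rightarrow> real^3) \<Rightarrow> bool" where
  "tangent_field T u \<longleftrightarrow>
     smooth_curve u \<and> (\<forall>x. u (x + T) = u x)
   \<and> u 0 = 0 \<and> vderiv 1 u 0 = 0 \<and> vderiv 2 u 0 = 0"

section \<open>Closed continuous 2-friezes\<close>

definition dX :: "(real \<Rightarrow> real \<Rightarrow> real) \<Rightarrow> real \<Rightarrow> real \<Rightarrow> real" where
  "dX f x y = deriv (\<lambda>s. f s y) x"

definition dY :: "(real \<Rightarrow> real \<Rightarrow> real) \<Rightarrow> real \<Rightarrow> real \<Rightarrow> real" where
  "dY f x y = deriv (\<lambda>s. f x s) y"

text \<open>All iterated partial derivatives, in any order, exist and are (totally) differentiable.\<close>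

definition smooth2 :: "(real \<Rightarrow> real \<Rightarrow> real) \<Rightarrow> bool" where
  "smooth2 f \<longleftrightarrow>
     (\<forall>Ds p. set Ds \<subseteq> {dX, dY} \<longrightarrow>
        (\<lambda>(x, y). fold (\<lambda>D g. D g) Ds f x y) differentiable (at p))"

definition frieze_boundary :: "real \<Rightarrow> (real \<Rightarrow> real \<Rightarrow> real) \<Rightarrow> bool" where
  "frieze_boundary T f \<longleftrightarrow>
     (\<forall>x. f x x = 0 \<and> dX f x x = 0 \<and> dY f x x = 0
        \<and> dX (dX f) x x = 1 \<and> dY (dY f) x x = 1 \<and> dY (dX f) x x = -1)
   \<and> (\<forall>x y. f (x + T) y = f x y \<and> f x (y + T) = f x y)"

definition closed_continuous_2frieze ::
  "real \<Rightarrow> (real \<Rightarrow> real \<Rightarrow> real) \<Rightarrow> (real \<Rightarrow> real \<Rightarrow> real) \<Rightarrow> bool" where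
  "closed_continuous_2frieze T F G \<longleftrightarrow>
     smooth2 F \<and> smooth2 G
   \<and> (\<forall>x y. G x y = F x y * dY (dX F) x y - dX F x y * dY F x y)
   \<and> (\<forall>x y. F x y = G x y * dY (dX G) x y - dX G x y * dY G x y)
   \<and> frieze_boundary T F \<and> frieze_boundary T G"

definition frieze_F :: "(real \<Rightarrow> real^3) \<Rightarrow> real \<Rightarrow> real \<Rightarrow> real" where
  "frieze_F \<Gamma> x y = det3 (\<Gamma> x) (\<Gamma> y) (vderiv 1 \<Gamma> y)"

definition frieze_G :: "(real \<Rightarrow> real^3) \<Rightarrow> real \<Rightarrow> real \<Rightarrow> real" where
  "frieze_G \<Gamma> x y = frieze_F \<Gamma> y x"

section \<open>The continuous limit of the cluster form\<close>

definition cluster_substituted ::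
  "(real \<Rightarrow> real^3) \<Rightarrow> (real \<Rightarrow> real^3) \<Rightarrow> (real \<Rightarrow> real^3) \<Rightarrow> real \<Rightarrow> real \<Rightarrow> real \<Rightarrow> real" where
  "cluster_substituted \<Gamma> u v x y \<epsilon> =
     cluster_summand (\<lambda>\<Gamma>. frieze_F \<Gamma> (x - \<epsilon>) (y - \<epsilon>)) (\<lambda>\<Gamma>. frieze_F \<Gamma> (x + \<epsilon>) (y - \<epsilon>))
                     (\<lambda>\<Gamma>. frieze_G \<Gamma> x y) (\<lambda>\<Gamma>. frieze_G \<Gamma> (x + 2 * \<epsilon>) y) \<Gamma> u v"

text \<open>The coefficient of \<open>\<epsilon>\<close>.\<close>

definition cluster_density ::
  "(real \<Rightarrow> real^3) \<Rightarrow> (real \<Rightarrow> real^3) \<Rightarrow> (real \<Rightarrow> real^3) \<Rightarrow> real \<Rightarrow> real \<Rightarrow> real" where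
  "cluster_density \<Gamma> u v x y = deriv (\<lambda>\<epsilon>. cluster_substituted \<Gamma> u v x y \<epsilon>) 0"

definition cluster_limit ::
  "real \<Rightarrow> (real \<Rightarrow> real^3) \<Rightarrow> (real \<Rightarrow> real^3) \<Rightarrow> (real \<Rightarrow> real^3) \<Rightarrow> real" where
  "cluster_limit T \<Gamma> u v = integral {0..T} (\<lambda>x. cluster_density \<Gamma> u v x 0)"

section \<open>The Adler-Gelfand-Dikii form\<close>

definition wronskian :: "(real \<Rightarrow> real^3) \<Rightarrow> real \<Rightarrow> real" where
  "wronskian \<Gamma> x =
     \<Gamma> x $ 1 * deriv (\<lambda>s. \<Gamma> s $ 2) x - deriv (\<lambda>s. \<Gamma> s $ 1) x * \<Gamma> x $ 2"

definition a1 :: "(real \<Rightarrow> real^3) \<Rightarrow> real \<Rightarrow> real" where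
  "a1 \<Gamma> x = - deriv (\<lambda>s. \<Gamma> s $ 1) x / \<Gamma> x $ 1"

definition a2 :: "(real \<Rightarrow> real^3) \<Rightarrow> real \<Rightarrow> real" where
  "a2 \<Gamma> x = deriv (\<lambda>s. \<Gamma> s $ 1) x / \<Gamma> x $ 1 - deriv (wronskian \<Gamma>) x / wronskian \<Gamma> x"

text \<open>
  The circle is cut at 0, and the antiderivative is the one vanishing there. When the variations
  of \<open>a\<^sub>1\<close> and \<open>a\<^sub>2\<close> have zero mean, it is periodic and adding a constant to it does not change the
  form. At the end points 0 and \<open>T\<close> themselves \<open>a\<^sub>1\<close> and \<open>a\<^sub>2\<close> have poles and take irrelevant values.
\<close>

definition antideriv :: "(real \<Rightarrow> real) \<Rightarrow> real \<Rightarrow> real" where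
  "antideriv h x = integral {0..x} h"

definition agd_density ::
  "(real \<Rightarrow> real^3) \<Rightarrow> (real \<Rightarrow> real^3) \<Rightarrow> (real \<Rightarrow> real^3) \<Rightarrow> real \<Rightarrow> real" where
  "agd_density \<Gamma> u v x =
     (vector [antideriv (\<lambda>s. variation (\<lambda>\<Gamma>. a1 \<Gamma> s) \<Gamma> u) x,
              antideriv (\<lambda>s. variation (\<lambda>\<Gamma>. a2 \<Gamma> s) \<Gamma> u) x] :: real^2)
     \<bullet> ((vector [vector [2, 1], vector [1, 2]] :: real^2^2)
         *v vector [variation (\<lambda>\<Gamma>. a1 \<Gamma> x) \<Gamma> v, variation (\<lambda>\<Gamma>. a2 \<Gamma> x) \<Gamma> v])"

definition omega_AGD ::
  "real \<Rightarrow> (real \<Rightarrow> real^3) \<Rightarrow> (real \<Rightarrow> real^3) \<Rightarrow> (real \<Rightarrow> real^3) \<Rightarrow> real" where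
  "omega_AGD T \<Gamma> u v = integral {0..T} (agd_density \<Gamma> u v)"

end

theory Submission
  imports Defs
begin

text \<open>
  Write \<open>p\<^sub>u = u(y\<^sub>1)/y\<^sub>1\<close> and \<open>q\<^sub>u = u(W)/W\<close> for the logarithmic variations of \<open>F(x, 0)\<close> and
  \<open>G(x, 0)\<close>. Then \<open>u(a\<^sub>1) = - p\<^sub>u'\<close> and \<open>u(a\<^sub>2) = p\<^sub>u' - q\<^sub>u'\<close>, while the cluster form is built from the
  one-forms \<open>d log x\<^sub>i\<close>, \<open>d log y\<^sub>i\<close>, so that both densities are bilinear in \<open>p\<close>, \<open>q\<close> and their first
  derivatives:
  the AGD density is \<open>2 p\<^sub>u p\<^sub>v' + 2 q\<^sub>u q\<^sub>v' - p\<^sub>u q\<^sub>v' - q\<^sub>u p\<^sub>v'\<close>, and adding twice it to the cluster density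
  gives \<open>2 (p\<^sub>u p\<^sub>v + q\<^sub>u q\<^sub>v - p\<^sub>u q\<^sub>v)'\<close>. By convexity \<open>y\<^sub>1\<close> and \<open>W\<close> vanish only at the ends of the
  period. There they have double zeros, whereas their variations vanish to third order, so \<open>p\<close> and \<open>q\<close>
  are \<open>C\<^sup>1\<close> up to the ends and vanish there. Hence the exact term integrates to zero and the factor
  is \<open>-2\<close>.
\<close>

section \<open>Smooth curves and polynomials in their derivatives\<close>

lemma det3_expand:
  "det3 a b c = a$1 * (b$2 * c$3 - b$3 * c$2) - a$2 * (b$1 * c$3 - b$3 * c$1)
     + a$3 * (b$1 * c$2 - b$2 * c$1)"
  unfolding det3_def by (simp add: det_3 vector_3 algebra_simps)

lemma vderiv_0 [simp]: "vderiv 0 f = f"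
  by (simp add: vderiv_def)

lemma has_vector_derivative_vderiv:
  assumes "smooth_curve f"
  shows "(vderiv n f has_vector_derivative vderiv (Suc n) f x) (at x)"
  using assms unfolding smooth_curve_def
  by (simp add: vderiv_def vector_derivative_works)

lemma has_real_derivative_vderiv:
  assumes "smooth_curve f"
  shows "((\<lambda>x. vderiv n f x $ i) has_real_derivative vderiv (Suc n) f x $ i) (at x within S)"
  using has_vector_derivative_vderiv[OF assms, of n x]
  unfolding has_real_derivative_iff_has_vector_derivative
  by (auto intro: bounded_linear.has_vector_derivative[OF bounded_linear_vec_nth]
      has_vector_derivative_at_within)

lemma has_real_derivative_nth:
  assumes "smooth_curve f"
  shows "((\<lambda>x. f x $ i) has_real_derivative vderiv 1 f x $ i) (at x within S)"
  using has_real_derivative_vderiv[OF assms, of 0] by simp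

lemma deriv_nth:
  assumes "smooth_curve f"
  shows "deriv (\<lambda>x. f x $ i) x = vderiv 1 f x $ i"
  using has_real_derivative_nth[OF assms] DERIV_imp_deriv by blast

text \<open>Differentiation is linear, so every jet of the deformed curve is affine in t. Quantities
  polynomial in the jets become polynomials in t, and their variations become explicit.\<close>

lemma vderiv_deform:
  assumes "smooth_curve f" "smooth_curve u"
  shows "vderiv n (\<lambda>s. f s + t *\<^sub>R u s) = (\<lambda>s. vderiv n f s + t *\<^sub>R vderiv n u s)"
proof (induction n)
  case (Suc n)
  have "vderiv (Suc n) (\<lambda>s. f s + t *\<^sub>R u s) x = vderiv (Suc n) f x + t *\<^sub>R vderiv (Suc n) u x" for x
  proof -
    have "((\<lambda>s. vderiv n f s + t *\<^sub>R vderiv n u s) has_vector_derivative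
        vderiv (Suc n) f x + t *\<^sub>R vderiv (Suc n) u x) (at x)"
      by (intro has_vector_derivative_add has_vector_derivative_vderiv assms
          bounded_linear.has_vector_derivative[OF bounded_linear_scaleR_right])
    then show ?thesis
      using Suc vector_derivative_at by (fastforce simp: vderiv_def)
  qed
  then show ?case by auto
qed simp

lemma smooth_curve_deform:
  assumes "smooth_curve f" "smooth_curve u"
  shows "smooth_curve (\<lambda>s. f s + t *\<^sub>R u s)"
  using assms by (auto simp: smooth_curve_def vderiv_deform[OF assms])

lemma vderiv_periodic:
  assumes "smooth_curve f" "\<And>x. f (x + T) = f x"
  shows "vderiv n f (x + T) = vderiv n f x"
proof (induction n arbitrary: x)
  case (Suc n)
  have "((\<lambda>s. vderiv n f (s + T)) has_vector_derivative vderiv (Suc n) f (x + T)) (at x)"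
  proof -
    have "((\<lambda>s. s + T) has_vector_derivative 1) (at x)"
      by (auto intro!: derivative_eq_intros)
    from vector_diff_chain_at[OF this has_vector_derivative_vderiv[OF assms(1)]]
    show ?thesis by (simp add: o_def)
  qed
  then show ?case
    unfolding Suc
    using has_vector_derivative_vderiv[OF assms(1), of n x] vector_derivative_unique_at by blast
qed (simp add: assms)

text \<open>\<open>smooth2\<close> speaks of all words in \<open>dX\<close> and \<open>dY\<close>,
  which calls for a class of totally differentiable functions closed under both. The curve may
  change from factor to factor, so that the class also contains expressions mixing \<Gamma> with a
  field u.\<close>

inductive curve_poly :: "(real \<Rightarrow> real \<Rightarrow> real) \<Rightarrow> bool" where
  const: "curve_poly (\<lambda>x y. a)"
| fst: "smooth_curve c \<Longrightarrow> curve_poly (\<lambda>x y. vderiv n c x $ i)"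
| snd: "smooth_curve c \<Longrightarrow> curve_poly (\<lambda>x y. vderiv n c y $ i)"
| add: "curve_poly f \<Longrightarrow> curve_poly g \<Longrightarrow> curve_poly (\<lambda>x y. f x y + g x y)"
| diff: "curve_poly f \<Longrightarrow> curve_poly g \<Longrightarrow> curve_poly (\<lambda>x y. f x y - g x y)"
| mult: "curve_poly f \<Longrightarrow> curve_poly g \<Longrightarrow> curve_poly (\<lambda>x y. f x y * g x y)"

text \<open>The derivative is total: the chain rule will be applied to it along slanted lines in the
  (x, y) plane.\<close>

definition partials :: "(real \<Rightarrow> real \<Rightarrow> real) \<Rightarrow> (real \<Rightarrow> real \<Rightarrow> real) \<Rightarrow> (real \<Rightarrow> real \<Rightarrow> real) \<Rightarrow> bool" where
  "partials f g h \<longleftrightarrow> (\<forall>p. ((\<lambda>p. f (fst p) (snd p)) has_derivative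
     (\<lambda>d. g (fst p) (snd p) * fst d + h (fst p) (snd p) * snd d)) (at p))"

lemma curve_poly_partials:
  assumes "curve_poly f"
  shows "\<exists>g h. curve_poly g \<and> curve_poly h \<and> partials f g h"
  using assms
proof induction
  case (const a)
  show ?case
    by (rule exI[of _ "\<lambda>x y. 0"], rule exI[of _ "\<lambda>x y. 0"])
      (simp add: partials_def curve_poly.const)
next
  case (fst c n i)
  have "((\<lambda>p. vderiv n c (fst p) $ i) has_derivative (\<lambda>d. vderiv (Suc n) c (fst p) $ i * fst d)) (at p)"
    for p :: "real \<times> real"
    by (rule has_derivative_compose[OF has_derivative_fst[OF has_derivative_ident]
        has_real_derivative_vderiv[OF fst, of n i, unfolded has_field_derivative_def]])
  then show ?case
    by (intro exI[of _ "\<lambda>x y. vderiv (Suc n) c x $ i"] exI[of _ "\<lambda>x y. 0"])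
      (simp add: partials_def curve_poly.const curve_poly.fst fst)
next
  case (snd c n i)
  have "((\<lambda>p. vderiv n c (snd p) $ i) has_derivative (\<lambda>d. vderiv (Suc n) c (snd p) $ i * snd d)) (at p)"
    for p :: "real \<times> real"
    by (rule has_derivative_compose[OF has_derivative_snd[OF has_derivative_ident]
        has_real_derivative_vderiv[OF snd, of n i, unfolded has_field_derivative_def]])
  then show ?case
    by (intro exI[of _ "\<lambda>x y. 0"] exI[of _ "\<lambda>x y. vderiv (Suc n) c y $ i"])
      (simp add: partials_def curve_poly.const curve_poly.snd snd)
next
  case (add f1 f2)
  then obtain g1 h1 g2 h2 where *: "curve_poly g1" "curve_poly h1" "partials f1 g1 h1"
    "curve_poly g2" "curve_poly h2" "partials f2 g2 h2" by blast
  have "partials (\<lambda>x y. f1 x y + f2 x y) (\<lambda>x y. g1 x y + g2 x y) (\<lambda>x y. h1 x y + h2 x y)"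
    unfolding partials_def
  proof
    fix p
    show "((\<lambda>p. f1 (fst p) (snd p) + f2 (fst p) (snd p)) has_derivative
        (\<lambda>d. (g1 (fst p) (snd p) + g2 (fst p) (snd p)) * fst d
          + (h1 (fst p) (snd p) + h2 (fst p) (snd p)) * snd d)) (at p)"
      by (rule has_derivative_eq_rhs[OF has_derivative_add[OF *(3)[unfolded partials_def, rule_format]
            *(6)[unfolded partials_def, rule_format]]]) (simp add: algebra_simps)
  qed
  then show ?case
    using curve_poly.add[OF *(1,4)] curve_poly.add[OF *(2,5)] by blast
next
  case (diff f1 f2)
  then obtain g1 h1 g2 h2 where *: "curve_poly g1" "curve_poly h1" "partials f1 g1 h1"
    "curve_poly g2" "curve_poly h2" "partials f2 g2 h2" by blast
  have "partials (\<lambda>x y. f1 x y - f2 x y) (\<lambda>x y. g1 x y - g2 x y) (\<lambda>x y. h1 x y - h2 x y)"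
    unfolding partials_def
  proof
    fix p
    show "((\<lambda>p. f1 (fst p) (snd p) - f2 (fst p) (snd p)) has_derivative
        (\<lambda>d. (g1 (fst p) (snd p) - g2 (fst p) (snd p)) * fst d
          + (h1 (fst p) (snd p) - h2 (fst p) (snd p)) * snd d)) (at p)"
      by (rule has_derivative_eq_rhs[OF has_derivative_diff[OF *(3)[unfolded partials_def, rule_format]
            *(6)[unfolded partials_def, rule_format]]]) (simp add: algebra_simps)
  qed
  then show ?case
    using curve_poly.diff[OF *(1,4)] curve_poly.diff[OF *(2,5)] by blast
next
  case (mult f1 f2)
  then obtain g1 h1 g2 h2 where *: "curve_poly g1" "curve_poly h1" "partials f1 g1 h1"
    "curve_poly g2" "curve_poly h2" "partials f2 g2 h2" by blast
  have "partials (\<lambda>x y. f1 x y * f2 x y) (\<lambda>x y. f1 x y * g2 x y + g1 x y * f2 x y)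
      (\<lambda>x y. f1 x y * h2 x y + h1 x y * f2 x y)"
    unfolding partials_def
  proof
    fix p
    show "((\<lambda>p. f1 (fst p) (snd p) * f2 (fst p) (snd p)) has_derivative
        (\<lambda>d. (f1 (fst p) (snd p) * g2 (fst p) (snd p) + g1 (fst p) (snd p) * f2 (fst p) (snd p)) * fst d
          + (f1 (fst p) (snd p) * h2 (fst p) (snd p) + h1 (fst p) (snd p) * f2 (fst p) (snd p)) * snd d)) (at p)"
      by (rule has_derivative_eq_rhs[OF has_derivative_mult[OF *(3)[unfolded partials_def, rule_format]
            *(6)[unfolded partials_def, rule_format]]]) (simp add: algebra_simps)
  qed
  then show ?case
    using curve_poly.add[OF curve_poly.mult[OF mult.hyps(1) *(4)] curve_poly.mult[OF *(1) mult.hyps(2)]]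
      curve_poly.add[OF curve_poly.mult[OF mult.hyps(1) *(5)] curve_poly.mult[OF *(2) mult.hyps(2)]]
    by blast
qed

lemma partials_at:
  assumes "partials f g h"
  shows "((\<lambda>s. f s y) has_real_derivative g x y) (at x)"
    and "((\<lambda>s. f x s) has_real_derivative h x y) (at y)"
    and "dX f = g" and "dY f = h"
proof -
  have *: "((\<lambda>p. f (fst p) (snd p)) has_derivative (\<lambda>d. g x y * fst d + h x y * snd d)) (at (x, y))"
    for x y
    using assms[unfolded partials_def, rule_format, of "(x, y)"] by simp
  have "((\<lambda>s. (s, y)) has_derivative (\<lambda>d. (d, 0))) (at x)" for x y :: real
    by (rule has_derivative_Pair[OF has_derivative_ident has_derivative_const])
  from has_derivative_compose[OF this *]
  show X: "((\<lambda>s. f s y) has_real_derivative g x y) (at x)" for x y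
    by (simp add: has_field_derivative_def)
  have "((\<lambda>s. (x, s)) has_derivative (\<lambda>d. (0, d))) (at y)" for x y :: real
    by (rule has_derivative_Pair[OF has_derivative_const has_derivative_ident])
  from has_derivative_compose[OF this *]
  show Y: "((\<lambda>s. f x s) has_real_derivative h x y) (at y)" for x y
    by (simp add: has_field_derivative_def)
  show "dX f = g" "dY f = h"
    using DERIV_imp_deriv[OF X] DERIV_imp_deriv[OF Y] by (auto simp: dX_def dY_def fun_eq_iff)
qed

lemma smooth2_curve_poly:
  assumes "curve_poly f"
  shows "smooth2 f"
proof -
  have diff: "(\<lambda>(x, y). f x y) differentiable (at p)" if "curve_poly f" for f p
    using curve_poly_partials[OF that] unfolding partials_def differentiable_def case_prod_beta'
    by blast
  have "curve_poly (fold (\<lambda>D g. D g) Ds f)" if "set Ds \<subseteq> {dX, dY}" "curve_poly f" for Ds f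
    using that
  proof (induction Ds arbitrary: f)
    case (Cons D Ds)
    obtain g h where "curve_poly g" "curve_poly h" "partials f g h"
      using curve_poly_partials Cons.prems by blast
    then have "curve_poly (D f)"
      using Cons.prems partials_at by auto
    then show ?case using Cons by auto
  qed simp
  with diff assms show ?thesis unfolding smooth2_def by blast
qed

section \<open>The frieze of a curve\<close>

lemma has_real_derivative_det3:
  assumes "(a has_vector_derivative a') (at x)" "(b has_vector_derivative b') (at x)"
    "(c has_vector_derivative c') (at x)"
  shows "((\<lambda>s. det3 (a s) (b s) (c s)) has_real_derivative
    det3 a' (b x) (c x) + det3 (a x) b' (c x) + det3 (a x) (b x) c') (at x)"
proof -
  have "((\<lambda>s. f s $ i) has_real_derivative f' $ i) (at x)"
    if "(f has_vector_derivative f') (at x)" for f :: "real \<Rightarrow> real^3" and f' i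
    using bounded_linear.has_vector_derivative[OF bounded_linear_vec_nth that]
    by (simp add: has_real_derivative_iff_has_vector_derivative)
  note * = this[OF assms(1)] this[OF assms(2)] this[OF assms(3)]
  show ?thesis
    unfolding det3_expand
    by (rule derivative_eq_intros * refl)+ (simp add: algebra_simps)
qed

text \<open>Modulo b the vectors lie in a plane, and each factor is, up to sign, an area in that
  plane. The identity is the three-term Pluecker relation for x, x', c, d there; the signs on the
  right cancel in pairs.\<close>

lemma det3_pluecker:
  "det3 b x x' * det3 b c d = det3 x b c * det3 x' b d - det3 x' b c * det3 x b d"
  unfolding det3_expand by (simp add: algebra_simps)

text \<open>A family that contains F and is closed under \<open>dX\<close> and, up to sums, under
  \<open>dY\<close>: k counts derivatives at x, while m and n count those of the two vectors at
  y.\<close>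

definition frieze_jet :: "(real \<Rightarrow> real^3) \<Rightarrow> nat \<Rightarrow> nat \<Rightarrow> nat \<Rightarrow> real \<Rightarrow> real \<Rightarrow> real" where
  "frieze_jet \<Gamma> k m n x y = det3 (vderiv k \<Gamma> x) (vderiv m \<Gamma> y) (vderiv n \<Gamma> y)"

lemma frieze_F_jet: "frieze_F \<Gamma> = frieze_jet \<Gamma> 0 0 1"
  by (simp add: frieze_F_def frieze_jet_def fun_eq_iff)

lemma frieze_jet_same [simp]: "frieze_jet \<Gamma> k m m x y = 0"
  by (simp add: frieze_jet_def det3_expand algebra_simps)

lemma curve_poly_det3:
  assumes "\<And>i. curve_poly (\<lambda>x y. a x y $ i)" "\<And>i. curve_poly (\<lambda>x y. b x y $ i)"
    "\<And>i. curve_poly (\<lambda>x y. c x y $ i)"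
  shows "curve_poly (\<lambda>x y. det3 (a x y) (b x y) (c x y))"
  unfolding det3_expand by (intro curve_poly.intros assms)

lemma curve_poly_swap: "curve_poly f \<Longrightarrow> curve_poly (\<lambda>x y. f y x)"
  by (induction rule: curve_poly.induct) (auto intro: curve_poly.intros)

lemma dX_swap: "dX (\<lambda>x y. f y x) = (\<lambda>x y. dY f y x)"
  and dY_swap: "dY (\<lambda>x y. f y x) = (\<lambda>x y. dX f y x)"
  by (auto simp: dX_def dY_def fun_eq_iff)

context
  fixes \<Gamma> :: "real \<Rightarrow> real^3"
  assumes smooth: "smooth_curve \<Gamma>"
begin

lemma has_real_derivative_frieze_jet:
  shows "((\<lambda>s. frieze_jet \<Gamma> k m n s y) has_real_derivative frieze_jet \<Gamma> (Suc k) m n x y) (at x)"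
    and "((\<lambda>s. frieze_jet \<Gamma> k m n x s) has_real_derivative
      frieze_jet \<Gamma> k (Suc m) n x y + frieze_jet \<Gamma> k m (Suc n) x y) (at y)"
proof -
  note v = has_vector_derivative_vderiv[OF smooth] has_vector_derivative_const
  show "((\<lambda>s. frieze_jet \<Gamma> k m n s y) has_real_derivative frieze_jet \<Gamma> (Suc k) m n x y) (at x)"
    unfolding frieze_jet_def
    by (rule DERIV_cong[OF has_real_derivative_det3[OF v(1) v(2) v(2)]]) (simp add: det3_expand)
  show "((\<lambda>s. frieze_jet \<Gamma> k m n x s) has_real_derivative
      frieze_jet \<Gamma> k (Suc m) n x y + frieze_jet \<Gamma> k m (Suc n) x y) (at y)"
    unfolding frieze_jet_def
    by (rule DERIV_cong[OF has_real_derivative_det3[OF v(2) v(1) v(1)]]) (simp add: det3_expand)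
qed

lemma dX_frieze_jet: "dX (frieze_jet \<Gamma> k m n) = frieze_jet \<Gamma> (Suc k) m n"
  by (auto simp: dX_def fun_eq_iff intro!: DERIV_imp_deriv has_real_derivative_frieze_jet)

lemma dY_frieze_jet:
  "dY (frieze_jet \<Gamma> k m n) = (\<lambda>x y. frieze_jet \<Gamma> k (Suc m) n x y + frieze_jet \<Gamma> k m (Suc n) x y)"
  by (auto simp: dY_def fun_eq_iff intro!: DERIV_imp_deriv has_real_derivative_frieze_jet)

lemma curve_poly_frieze_F: "curve_poly (frieze_F \<Gamma>)"
  unfolding frieze_F_jet frieze_jet_def
  by (intro curve_poly_det3 curve_poly.fst curve_poly.snd smooth)

text \<open>The local rule for F is a Pluecker relation, and the rule for G is the same relation
  with x and y exchanged. On the diagonal everything reduces to determinants of jets at one point,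
  which are 0 by a repeated vector or 1 or -1 by unimodularity.\<close>

lemma closed_continuous_2frieze_lift:
  assumes periodic: "\<And>x. \<Gamma> (x + T) = \<Gamma> x"
    and unimodular: "\<And>x. det3 (\<Gamma> x) (vderiv 1 \<Gamma> x) (vderiv 2 \<Gamma> x) = 1"
  shows "closed_continuous_2frieze T (frieze_F \<Gamma>) (frieze_G \<Gamma>)"
proof -
  let ?J = "frieze_jet \<Gamma>"
  have F_y: "dY (?J k 0 1) = ?J k 0 2" for k
    by (simp add: dY_frieze_jet fun_eq_iff numeral_2_eq_2)
  have F: "dX (frieze_F \<Gamma>) = ?J 1 0 1" "dY (frieze_F \<Gamma>) = ?J 0 0 2"
    "dX (dX (frieze_F \<Gamma>)) = ?J 2 0 1" "dY (dX (frieze_F \<Gamma>)) = ?J 1 0 2"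
    using F_y[of 0] F_y[of 1] by (simp_all add: frieze_F_jet dX_frieze_jet numeral_2_eq_2)
  have G1: "frieze_G \<Gamma> = (\<lambda>x y. frieze_F \<Gamma> y x)"
    by (simp add: frieze_G_def fun_eq_iff)
  have G: "frieze_G \<Gamma> = (\<lambda>x y. frieze_F \<Gamma> y x)" "dX (frieze_G \<Gamma>) = (\<lambda>x y. ?J 0 0 2 y x)"
    "dY (frieze_G \<Gamma>) = (\<lambda>x y. ?J 1 0 1 y x)"
    unfolding G1 dX_swap[of "frieze_F \<Gamma>"] dY_swap[of "frieze_F \<Gamma>"] F by simp_all
  have GG: "dX (dX (frieze_G \<Gamma>)) = (\<lambda>x y. dY (?J 0 0 2) y x)"
    "dY (dX (frieze_G \<Gamma>)) = (\<lambda>x y. ?J 1 0 2 y x)"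
    "dY (dY (frieze_G \<Gamma>)) = (\<lambda>x y. ?J 2 0 1 y x)"
    unfolding G(2,3) dX_swap[of "?J 0 0 2"] dY_swap[of "?J 0 0 2"] dY_swap[of "?J 1 0 1"]
    by (simp_all add: dX_frieze_jet numeral_2_eq_2)
  \<comment> \<open>The product rule gives jets of orders (0, 1, 2) and (0, 0, 3). On the diagonal
    the first is the unimodular determinant and the second repeats \<Gamma> x.\<close>
  have F_yy: "dY (?J 0 0 2) x x = 1" for x
    using unimodular[of x]
    by (simp add: dY_frieze_jet frieze_jet_def det3_expand algebra_simps)
  have diag: "?J 1 0 2 x x = -1" "?J 2 0 1 x x = 1" "?J 1 0 1 x x = 0" "?J 0 0 n x x = 0" for x n
    using unimodular[of x]
    by (simp_all add: frieze_jet_def det3_expand algebra_simps)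
  have eq: "frieze_F \<Gamma> y x = frieze_F \<Gamma> x y * dY (dX (frieze_F \<Gamma>)) x y
      - dX (frieze_F \<Gamma>) x y * dY (frieze_F \<Gamma>) x y" for x y
  proof -
    \<comment> \<open>The Pluecker relation with b, c, d the 2-jet of \<Gamma> at y and x, x' the
      1-jet at x; the second factor on the left is 1.\<close>
    have "frieze_F \<Gamma> y x * det3 (\<Gamma> y) (vderiv 1 \<Gamma> y) (vderiv 2 \<Gamma> y) =
      ?J 0 0 1 x y * ?J 1 0 2 x y - ?J 1 0 1 x y * ?J 0 0 2 x y"
      unfolding frieze_F_def frieze_jet_def vderiv_0 by (rule det3_pluecker)
    then show ?thesis
      using unimodular[of y] unfolding F F_y by (simp add: frieze_F_jet)
  qed
  have "?J 0 0 1 (x + T) y = ?J 0 0 1 x y" "?J 0 0 1 x (y + T) = ?J 0 0 1 x y" for x y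
    by (simp_all add: frieze_jet_def periodic vderiv_periodic[OF smooth periodic])
  then have boundary: "frieze_boundary T (frieze_F \<Gamma>)" "frieze_boundary T (frieze_G \<Gamma>)"
    unfolding frieze_boundary_def GG F(3,4) unfolding F(1,2) G(2,3) unfolding G(1)
    unfolding frieze_F_jet using diag F_yy by auto
  show ?thesis
    unfolding closed_continuous_2frieze_def
  proof (intro conjI allI)
    show "smooth2 (frieze_F \<Gamma>)"
      by (rule smooth2_curve_poly[OF curve_poly_frieze_F])
    show "smooth2 (frieze_G \<Gamma>)"
      unfolding G(1) by (rule smooth2_curve_poly[OF curve_poly_swap[OF curve_poly_frieze_F]])
    show "frieze_G \<Gamma> x y = frieze_F \<Gamma> x y * dY (dX (frieze_F \<Gamma>)) x y
      - dX (frieze_F \<Gamma>) x y * dY (frieze_F \<Gamma>) x y" for x y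
      using eq[of y x] by (simp add: frieze_G_def)
    show "frieze_F \<Gamma> x y = frieze_G \<Gamma> x y * dY (dX (frieze_G \<Gamma>)) x y
      - dX (frieze_G \<Gamma>) x y * dY (frieze_G \<Gamma>) x y" for x y
      using eq[of x y] unfolding GG F(3,4) unfolding F(1,2) G(2,3)
      by (simp add: frieze_G_def mult.commute)
  qed (use boundary in auto)
qed

end

section \<open>Convexity and zeros of the frieze\<close>

text \<open>One integration of a leading term: if f' behaves like L h^k, then f behaves like L
  h^(k+1) / (k+1). Iteration yields orders of vanishing together with leading coefficients.\<close>

lemma lhopital_over_power:
  fixes f f' :: "real \<Rightarrow> real"
  assumes "\<And>x. (f has_real_derivative f' x) (at x)" "f a = 0"
    and "((\<lambda>x. f' x / (x - a) ^ k) \<longlongrightarrow> L) (at a)"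
  shows "((\<lambda>x. f x / (x - a) ^ Suc k) \<longlongrightarrow> L / Suc k) (at a)"
proof (rule lhopital)
  have "isCont f a" using assms(1) DERIV_isCont by blast
  then show "f \<midarrow>a\<rightarrow> 0" using assms(2) by (simp add: isCont_def)
  show "(\<lambda>x. (x - a) ^ Suc k) \<midarrow>a\<rightarrow> 0"
    by (rule tendsto_eq_intros refl)+ simp
  have *: "\<forall>\<^sub>F x in at a. x \<noteq> a" by (simp add: eventually_at_filter)
  show "\<forall>\<^sub>F x in at a. (x - a) ^ Suc k \<noteq> 0" "\<forall>\<^sub>F x in at a. Suc k * (x - a) ^ k \<noteq> 0"
    using * by (eventually_elim, simp)+
  show "\<forall>\<^sub>F x in at a. (f has_real_derivative f' x) (at x)" using assms(1) by simp
  show "\<forall>\<^sub>F x in at a. ((\<lambda>x. (x - a) ^ Suc k) has_real_derivative Suc k * (x - a) ^ k) (at x)"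
    by (intro always_eventually allI) (auto intro!: derivative_eq_intros simp del: power_Suc)
  show "((\<lambda>x. f' x / (Suc k * (x - a) ^ k)) \<longlongrightarrow> L / Suc k) (at a)"
    using tendsto_divide[OF assms(3) tendsto_const[of "real (Suc k)"]]
    by (simp add: divide_divide_eq_left mult.commute)
qed

text \<open>The exponent 1 is written out so that this serves as the starting point k = 1 for
  \<open>lhopital_over_power\<close>.\<close>

lemma tendsto_difference_quotient:
  fixes f :: "real \<Rightarrow> real"
  assumes "(f has_real_derivative d) (at a)" "f a = 0"
  shows "((\<lambda>x. f x / (x - a) ^ 1) \<longlongrightarrow> d) (at a)"
  using assms by (simp add: has_field_derivative_iff)

lemma periodic_of_int:
  assumes "\<And>x::real. f (x + T) = f x"
  shows "f (x + of_int k * T) = f x"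
proof (induction k arbitrary: x rule: int_induct[where k = 0])
  case base
  then show ?case by simp
next
  case (step1 i)
  then show ?case using assms[of "x + of_int i * T"] by (simp add: algebra_simps)
next
  case (step2 i)
  then show ?case using assms[of "x + of_int (i - 1) * T"] by (simp add: algebra_simps)
qed

text \<open>Convexity counts zeros in the window {0..<T}. Points less than T apart with equal
  residues modulo T coincide, so the bound of two carries over to a window starting
  anywhere.\<close>

lemma closed_convex_lift_three_zeros:
  assumes "closed_convex_lift T \<Gamma>" "l \<noteq> 0"
    and "z1 < z2" "z2 < z3" "z3 < z1 + T"
    and "l \<bullet> \<Gamma> z1 = 0" "l \<bullet> \<Gamma> z2 = 0" "l \<bullet> \<Gamma> z3 = 0"
  shows False
proof -
  have T: "T > 0" and per: "\<And>x. \<Gamma> (x + T) = \<Gamma> x"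
    using assms(1) by (auto simp: closed_convex_lift_def)
  let ?Z = "{x \<in> {0..<T}. l \<bullet> \<Gamma> x = 0}"
  have Z: "finite ?Z" "card ?Z \<le> 2"
    using assms(1,2) by (auto simp: closed_convex_lift_def)
  define r where "r z = z - of_int \<lfloor>z / T\<rfloor> * T" for z
  have "\<Gamma> (r z) = \<Gamma> z" for z
    using periodic_of_int[of \<Gamma> T, OF per, of "r z" "\<lfloor>z / T\<rfloor>"] by (simp add: r_def)
  moreover have "r z \<in> {0..<T}" for z
    using T floor_divide_lower[OF T, of z] floor_divide_upper[OF T, of z]
    by (simp add: r_def algebra_simps)
  ultimately have sub: "r ` {z1, z2, z3} \<subseteq> ?Z"
    using assms(6-8) by auto
  have inj: "a = b" if "r a = r b" "\<bar>a - b\<bar> < T" for a b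
  proof -
    have "a - b = of_int (\<lfloor>a / T\<rfloor> - \<lfloor>b / T\<rfloor>) * T"
      using that(1) by (simp add: r_def algebra_simps)
    with that(2) T have "\<bar>real_of_int (\<lfloor>a / T\<rfloor> - \<lfloor>b / T\<rfloor>)\<bar> * T < 1 * T"
      by (simp add: abs_mult)
    then have "\<bar>real_of_int (\<lfloor>a / T\<rfloor> - \<lfloor>b / T\<rfloor>)\<bar> < 1"
      using T mult_less_cancel_right_pos by blast
    then have "\<lfloor>a / T\<rfloor> - \<lfloor>b / T\<rfloor> = 0" by linarith
    with \<open>a - b = _\<close> show ?thesis by simp
  qed
  have "r z1 \<noteq> r z2" "r z1 \<noteq> r z3" "r z2 \<noteq> r z3"
    using inj assms(3-5) by fastforce+
  then have "card (r ` {z1, z2, z3}) = 3" by simp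
  then show False
    using card_mono[OF Z(1) sub] Z(2) by linarith
qed

lemma det3_linear:
  obtains l where "\<And>v. det3 v a b = l \<bullet> v"
proof
  show "det3 v a b = vector [a$2 * b$3 - a$3 * b$2, a$3 * b$1 - a$1 * b$3, a$1 * b$2 - a$2 * b$1] \<bullet> v" for v
    by (simp add: det3_expand inner_vec_def sum_3 vector_3 algebra_simps)
qed

text \<open>
  The line through \<open>\<gamma> y\<close> tangent to the curve cannot meet it again at \<open>\<gamma> c\<close>: rotating it slightly
  about \<open>\<gamma> y\<close> would give a line with three intersections. If \<open>k c = 0\<close>, it keeps the intersections
  at \<open>y\<close> and \<open>c\<close> and gains one near \<open>y\<close>; otherwise \<open>c\<close>, where \<open>f\<close> has a local minimum, splits
  into two.
\<close>

lemma frieze_F_nonzero: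
  assumes lift: "closed_convex_lift T \<Gamma>" and c: "y < c" "c < y + T"
  shows "frieze_F \<Gamma> c y \<noteq> 0"
proof
  assume fc: "frieze_F \<Gamma> c y = 0"
  have T: "T > 0" and per: "\<And>x. \<Gamma> (x + T) = \<Gamma> x" and smooth: "smooth_curve \<Gamma>"
    and unimodular: "\<And>x. det3 (\<Gamma> x) (vderiv 1 \<Gamma> x) (vderiv 2 \<Gamma> x) = 1"
    using lift by (auto simp: closed_convex_lift_def)
  note zeros = closed_convex_lift_three_zeros[OF lift]
  define f where "f x = frieze_jet \<Gamma> 0 0 1 x y" for x
  \<comment> \<open>\<open>k\<close> is a second linear functional of \<Gamma> x vanishing at y,
    with derivative 1 there. The functions \<open>h d\<close> thus describe the lines through the
    point at y obtained by rotating the tangent.\<close>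
  define k where "k x = det3 (\<Gamma> y) (\<Gamma> x) (vderiv 2 \<Gamma> y)" for x
  define h where "h d x = f x - d * k x" for d x
  have per': "f (x + T) = f x" "k (x + T) = k x" for x
    by (simp_all add: f_def k_def frieze_jet_def per)
  have f': "(f has_real_derivative frieze_jet \<Gamma> 1 0 1 x y) (at x)"
    and f'': "((\<lambda>x. frieze_jet \<Gamma> 1 0 1 x y) has_real_derivative frieze_jet \<Gamma> 2 0 1 x y) (at x)" for x
    unfolding f_def using has_real_derivative_frieze_jet(1)[OF smooth, of _ 0 1 y x]
    by (simp_all add: numeral_2_eq_2)
  have k': "(k has_real_derivative det3 (\<Gamma> y) (vderiv 1 \<Gamma> x) (vderiv 2 \<Gamma> y)) (at x)" for x
    unfolding k_def
    by (rule DERIV_cong[OF has_real_derivative_det3[OF has_vector_derivative_const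
        has_vector_derivative_vderiv[OF smooth, of 0, unfolded vderiv_0] has_vector_derivative_const]])
      (simp add: det3_expand)
  have cont: "continuous_on S f" "continuous_on S (h d)" for S d
    unfolding h_def by (intro continuous_intros DERIV_continuous_on[OF DERIV_subset[OF f']]
        DERIV_continuous_on[OF DERIV_subset[OF k']] subset_UNIV)+
  have y: "f y = 0" "frieze_jet \<Gamma> 1 0 1 y y = 0" "frieze_jet \<Gamma> 2 0 1 y y = 1" "k y = 0"
    "det3 (\<Gamma> y) (vderiv 1 \<Gamma> y) (vderiv 2 \<Gamma> y) = 1"
    using unimodular[of y] by (simp_all add: f_def k_def frieze_jet_def det3_expand algebra_simps)
  have linear: "\<exists>l. \<forall>x. h d x = l \<bullet> \<Gamma> x" for d
  proof -
    obtain l1 l2 where "\<And>v. det3 v (\<Gamma> y) (vderiv 1 \<Gamma> y) = l1 \<bullet> v"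
      "\<And>v. det3 v (\<Gamma> y) (vderiv 2 \<Gamma> y) = l2 \<bullet> v"
      using det3_linear by metis
    moreover have "k x = - det3 (\<Gamma> x) (\<Gamma> y) (vderiv 2 \<Gamma> y)" for x
      by (simp add: k_def det3_expand algebra_simps)
    ultimately have "h d x = (l1 + d *\<^sub>R l2) \<bullet> \<Gamma> x" for x
      by (simp add: h_def f_def frieze_jet_def inner_add_left)
    then show ?thesis by blast
  qed
  \<comment> \<open>The value at m only certifies that the functional behind \<open>h d\<close> is
    not the zero functional, as convexity requires.\<close>
  have no_zeros: False if "h d m \<noteq> 0" "h d z1 = 0" "h d z2 = 0" "h d z3 = 0"
    "z1 < z2" "z2 < z3" "z3 < z1 + T" for d m z1 z2 z3
    using linear[of d] that zeros by (metis inner_zero_left)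
  have h0: "h 0 = f" by (simp add: h_def fun_eq_iff)
  have ivt: "\<exists>z. a < z \<and> z < b \<and> h d z = 0" if ab: "a < b" "h d a * h d b < 0" for a b d
  proof -
    consider "h d a < 0" "0 < h d b" | "h d b < 0" "0 < h d a"
      using ab(2) unfolding mult_less_0_iff by blast
    then obtain z where z: "a \<le> z" "z \<le> b" "h d z = 0"
      using IVT'[of "h d" a 0 b] IVT2'[of "h d" b 0 a] cont ab(1) by (metis less_imp_le)
    then show ?thesis using ab(2) by (metis less_eq_real_def mult_eq_0_iff order_less_irrefl)
  qed
  \<comment> \<open>Tangency: f has a double zero at y with second derivative 1, so f is positive on
    both sides of y.\<close>
  have "((\<lambda>x. f x / (x - y) ^ Suc 1) \<longlongrightarrow> 1 / Suc 1) (at y)"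
    using lhopital_over_power[OF f' y(1) tendsto_difference_quotient[OF f'' y(2)]] y(3)
    by simp
  then have "\<forall>\<^sub>F x in at y. 0 < f x / (x - y) ^ Suc 1"
    by (rule order_tendstoD) simp
  then have "\<forall>\<^sub>F x in at y. 0 < f x"
    by eventually_elim (auto simp: zero_less_divide_iff not_square_less_zero)
  then obtain e where e: "e > 0" "\<And>x. x \<noteq> y \<Longrightarrow> \<bar>x - y\<bar> < e \<Longrightarrow> 0 < f x"
    unfolding eventually_at by (auto simp: dist_real_def)
  \<comment> \<open>A zero at m would be a third one beside y and c. A negative value would force a
    zero on each side of m, again three together with y.\<close>
  have mid: "0 < f m" if m: "y < m" "m < y + T" "m \<noteq> c" for m
  proof -
    \<comment> \<open>Halving the minimum puts b strictly below all these bounds: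
      \<open>y + b\<close> and \<open>y + T - b\<close> have f positive, and m and c lie strictly
      between them.\<close>
    define b where "b = Min {e, m - y, c - y, y + T - m, y + T - c} / 2"
    have b: "0 < b" "b < e" "b < m - y" "b < c - y" "b < y + T - m" "b < y + T - c"
      using e m c by (auto simp: b_def)
    have pos: "0 < f (y + b)" "0 < f (y + T - b)"
      using e(2)[of "y + b"] e(2)[of "y - b"] per'(1)[of "y - b"] b by (simp_all add: algebra_simps)
    have ne: "f m \<noteq> 0"
    proof
      assume "f m = 0"
      consider "m < c" | "c < m" using m by linarith
      then show False
        using no_zeros[of 0 "y + b" y m c] no_zeros[of 0 "y + b" y c m] m c fc pos y \<open>f m = 0\<close>
        by (cases; force simp: h0 f_def frieze_F_jet)
    qed
    show ?thesis
    proof (rule ccontr)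
      assume "\<not> 0 < f m"
      with ne have neg: "f m < 0" by simp
      then have "f (y + b) * f m < 0" "f m * f (y + T - b) < 0"
        using pos by (simp_all add: mult_pos_neg mult_neg_pos)
      then obtain z1 z2 where "y + b < z1" "z1 < m" "f z1 = 0" "m < z2" "z2 < y + T - b" "f z2 = 0"
        using ivt[of "y + b" m 0] ivt[of m "y + T - b" 0] b by (auto simp: h0)
      then show False
        using no_zeros[of 0 m y z1 z2] b ne y by (simp add: h0)
    qed
  qed
  define m1 m2 where "m1 = (y + c) / 2" and "m2 = (c + (y + T)) / 2"
  have m: "y < m1" "m1 < c" "c < m2" "m2 < y + T"
    using c by (auto simp: m1_def m2_def)
  have fm: "0 < f m1" "0 < f m2" using mid m by auto
  \<comment> \<open>Small enough that subtracting d k with |d| = \<delta> leaves the values at m1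
    and m2 positive; the summand 1 makes the denominator positive and the bounds strict.\<close>
  define \<delta> where "\<delta> = min (f m1) (f m2) / (1 + \<bar>k m1\<bar> + \<bar>k m2\<bar>)"
  have \<delta>: "\<delta> > 0" "\<delta> * \<bar>k m1\<bar> < f m1" "\<delta> * \<bar>k m2\<bar> < f m2"
  proof -
    have p: "0 < 1 + \<bar>k m1\<bar> + \<bar>k m2\<bar>" by linarith
    then show "\<delta> > 0" using fm by (simp add: \<delta>_def)
    then have "\<delta> * \<bar>k m1\<bar> < \<delta> * (1 + \<bar>k m1\<bar> + \<bar>k m2\<bar>)" "\<delta> * \<bar>k m2\<bar> < \<delta> * (1 + \<bar>k m1\<bar> + \<bar>k m2\<bar>)"
      by (auto intro!: mult_strict_left_mono)
    moreover have "\<delta> * (1 + \<bar>k m1\<bar> + \<bar>k m2\<bar>) = min (f m1) (f m2)"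
      using p by (simp add: \<delta>_def)
    ultimately show "\<delta> * \<bar>k m1\<bar> < f m1" "\<delta> * \<bar>k m2\<bar> < f m2" by linarith+
  qed
  have hm: "0 < h d m1" "0 < h d m2" if "\<bar>d\<bar> = \<delta>" for d
  proof -
    have "d * k m1 \<le> \<delta> * \<bar>k m1\<bar>" "d * k m2 \<le> \<delta> * \<bar>k m2\<bar>"
      using that by (metis abs_ge_self abs_mult)+
    then show "0 < h d m1" "0 < h d m2" using \<delta> by (auto simp: h_def)
  qed
  have fc0: "f c = 0" using fc by (simp add: f_def frieze_F_jet)
  show False
  proof (cases "k c = 0")
    case True
    \<comment> \<open>Since f'(y) = 0 and k'(y) = 1, \<open>h \<delta>\<close> is negative just to
      the right of y but positive at m1. The zero in between joins those at y and c.\<close>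
    have "(h \<delta> has_real_derivative - \<delta>) (at y)"
      unfolding h_def using y(2,5) by (auto intro!: derivative_eq_intros f' k')
    from DERIV_neg_dec_right[OF this] \<delta>(1) obtain e where "e > 0" and e: "\<And>s. s > 0 \<Longrightarrow> s < e \<Longrightarrow> h \<delta> (y + s) < h \<delta> y"
      by auto
    define s where "s = min (e / 2) ((m1 - y) / 2)"
    have s: "0 < s" "s < e" "y + s < m1"
      using \<open>e > 0\<close> m by (auto simp: s_def min_def field_simps)
    have "h \<delta> y = 0" using y by (simp add: h_def)
    with e[OF s(1,2)] hm(1)[of \<delta>] \<delta>(1) have "h \<delta> (y + s) * h \<delta> m1 < 0"
      by (simp add: mult_neg_pos)
    then obtain z where "y + s < z" "z < m1" "h \<delta> z = 0"
      using ivt[OF s(3)] by blast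
    then show False
      using no_zeros[of \<delta> m1 y z c] hm(1)[of \<delta>] \<delta>(1) m c True fc0 s \<open>h \<delta> y = 0\<close>
      by (simp add: h_def)
  next
    case False
    \<comment> \<open>The sign makes d k(c) positive, so \<open>h d\<close> is negative at c and
      positive at m1 and m2: one zero on each side of c, besides y.\<close>
    define d where "d = \<delta> * sgn (k c)"
    have d: "\<bar>d\<bar> = \<delta>" using False \<delta>(1) by (simp add: d_def abs_mult abs_sgn_eq)
    have "h d c = - (\<delta> * \<bar>k c\<bar>)"
      by (simp add: h_def fc0 d_def abs_sgn)
    then have "h d c < 0" using \<delta>(1) False by simp
    with hm[OF d] have "h d m1 * h d c < 0" "h d c * h d m2 < 0"
      by (simp_all add: mult_pos_neg mult_neg_pos)
    then obtain z1 z2 where "m1 < z1" "z1 < c" "h d z1 = 0" "c < z2" "z2 < m2" "h d z2 = 0"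
      using ivt m by meson
    then show False
      using no_zeros[of d m1 y z1 z2] hm(1)[OF d] m y by (auto simp: h_def)
  qed
qed

section \<open>Functions vanishing at the ends of the period\<close>

text \<open>With h = x - a, N behaves like N3 h^3 / 6 and D like h^2 / 2. The quotient is therefore
  of order h, and in its derivative numerator and denominator are both of order h^4; the limit is N3
  / 3.\<close>

lemma quotient_limits:
  fixes N N1 N2 D D1 :: "real \<Rightarrow> real"
  assumes N: "\<And>x. (N has_real_derivative N1 x) (at x)" "\<And>x. (N1 has_real_derivative N2 x) (at x)"
      "(N2 has_real_derivative N3) (at a)" "N a = 0" "N1 a = 0" "N2 a = 0"
    and D: "\<And>x. (D has_real_derivative D1 x) (at x)" "(D1 has_real_derivative 1) (at a)"
      "D a = 0" "D1 a = 0"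
  shows "((\<lambda>x. N x / D x) \<longlongrightarrow> 0) (at a)"
    and "\<exists>L. ((\<lambda>x. (N1 x * D x - N x * D1 x) / (D x)\<^sup>2) \<longlongrightarrow> L) (at a)"
proof -
  note n2 = tendsto_difference_quotient[OF N(3,6)]
  note n1 = lhopital_over_power[OF N(2,5) n2]
  note n0 = lhopital_over_power[OF N(1,4) n1]
  note d1 = tendsto_difference_quotient[OF D(2,4)]
  note d0 = lhopital_over_power[OF D(1,3) d1]
  have ne: "\<forall>\<^sub>F x in at a. x \<noteq> a" by (simp add: eventually_at_filter)
  have x: "((\<lambda>x. x - a) \<longlongrightarrow> 0) (at a)" by (rule tendsto_eq_intros refl)+ simp
  have "((\<lambda>x. (x - a) * (N x / (x - a) ^ Suc (Suc 1)) / (D x / (x - a) ^ Suc 1)) \<longlongrightarrow> 0) (at a)"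
    by (rule tendsto_eq_intros x n0 d0 refl)+ auto
  then show "((\<lambda>x. N x / D x) \<longlongrightarrow> 0) (at a)"
    by (rule Lim_transform_eventually) (use ne in eventually_elim, auto simp: power2_eq_square divide_simps)
  \<comment> \<open>Numerator and denominator divided by h^4, with the powers distributed so that
    each factor has a known limit.\<close>
  have lim: "((\<lambda>x. (N1 x / (x - a) ^ Suc 1 * (D x / (x - a) ^ Suc 1)
      - N x / (x - a) ^ Suc (Suc 1) * (D1 x / (x - a) ^ 1)) / (D x / (x - a) ^ Suc 1)\<^sup>2)
      \<longlongrightarrow> (N3 / Suc 1 * (1 / Suc 1) - N3 / Suc 1 / Suc (Suc 1) * 1) / (1 / Suc 1)\<^sup>2) (at a)"
    by (intro tendsto_intros n0 n1 d0 d1) auto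
  have ev: "\<forall>\<^sub>F x in at a. (N1 x / (x - a) ^ Suc 1 * (D x / (x - a) ^ Suc 1)
      - N x / (x - a) ^ Suc (Suc 1) * (D1 x / (x - a) ^ 1)) / (D x / (x - a) ^ Suc 1)\<^sup>2
      = (N1 x * D x - N x * D1 x) / (D x)\<^sup>2"
    using ne
  proof eventually_elim
    case (elim x)
    define h where "h = x - a"
    have "h \<noteq> 0" using elim h_def by simp
    then have "N1 x / h ^ Suc 1 * (D x / h ^ Suc 1) - N x / h ^ Suc (Suc 1) * (D1 x / h ^ 1)
      = (N1 x * D x - N x * D1 x) / h ^ 4"
      by (simp add: field_simps power_numeral_reduce)
    moreover have "(D x / h ^ Suc 1)\<^sup>2 = (D x)\<^sup>2 / h ^ 4"
      by (simp add: power_divide power2_eq_square power4_eq_xxxx)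
    ultimately show ?case
      using \<open>h \<noteq> 0\<close> unfolding h_def[symmetric] by simp
  qed
  show "\<exists>L. ((\<lambda>x. (N1 x * D x - N x * D1 x) / (D x)\<^sup>2) \<longlongrightarrow> L) (at a)"
    by (rule exI, rule Lim_transform_eventually[OF lim ev])
qed

text \<open>At the ends \<open>p'\<close> records the continuous extension of the interior
  derivative. This is the form needed for the fundamental theorem of calculus on the closed
  period.\<close>

definition C1_vanishing :: "real \<Rightarrow> (real \<Rightarrow> real) \<Rightarrow> (real \<Rightarrow> real) \<Rightarrow> bool" where
  "C1_vanishing T p p' \<longleftrightarrow> continuous_on {0..T} p \<and> continuous_on {0..T} p' \<and> p 0 = 0 \<and> p T = 0
     \<and> (\<forall>x\<in>{0<..<T}. (p has_real_derivative p' x) (at x))"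

lemma continuous_extension_Icc:
  fixes f :: "real \<Rightarrow> real"
  assumes "0 < T" "\<And>x. 0 < x \<Longrightarrow> x < T \<Longrightarrow> isCont f x"
    and "(f \<longlongrightarrow> l0) (at 0)" "(f \<longlongrightarrow> lT) (at T)"
  shows "continuous_on {0..T} (\<lambda>x. if x = 0 then l0 else if x = T then lT else f x)"
    (is "continuous_on _ ?g")
proof (rule continuous_on_IccI)
  have ne: "\<forall>\<^sub>F x in at a. x \<noteq> b" for a b :: real
    by (rule eventually_neq_at_within)
  have tr: "(?g \<longlongrightarrow> l) (at a)" if "(f \<longlongrightarrow> l) (at a)" for a l
    by (rule Lim_transform_eventually[OF that]) (use ne[of 0 a] ne[of T a] in eventually_elim, simp)
  show "(?g \<longlongrightarrow> ?g 0) (at_right 0)" "(?g \<longlongrightarrow> ?g T) (at_left T)"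
    using tr[OF assms(3)] tr[OF assms(4)] assms(1)
    by (auto intro: filterlim_at_split[THEN iffD1, THEN conjunct1] filterlim_at_split[THEN iffD1, THEN conjunct2])
  show "?g \<midarrow>x\<rightarrow> ?g x" if "0 < x" "x < T" for x
    using tr[of "f x" x] assms(2)[OF that] that by (simp add: isCont_def)
qed (fact assms)

lemma quotient_C1_vanishing:
  fixes N N1 N2 D D1 D2 :: "real \<Rightarrow> real"
  assumes "0 < T"
    and N: "\<And>x. (N has_real_derivative N1 x) (at x)" "\<And>x. (N1 has_real_derivative N2 x) (at x)"
      "\<And>x. N2 differentiable (at x)" "\<And>a. a \<in> {0, T} \<Longrightarrow> N a = 0 \<and> N1 a = 0 \<and> N2 a = 0"
    and D: "\<And>x. (D has_real_derivative D1 x) (at x)" "\<And>x. (D1 has_real_derivative D2 x) (at x)"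
      "\<And>a. a \<in> {0, T} \<Longrightarrow> D a = 0 \<and> D1 a = 0 \<and> D2 a = 1"
    and nz: "\<And>x. 0 < x \<Longrightarrow> x < T \<Longrightarrow> D x \<noteq> 0"
  shows "\<exists>p'. C1_vanishing T (\<lambda>x. N x / D x) p'"
proof -
  define r where "r x = (N1 x * D x - N x * D1 x) / (D x)\<^sup>2" for x
  have lim: "((\<lambda>x. N x / D x) \<longlongrightarrow> 0) (at a)" "\<exists>L. (r \<longlongrightarrow> L) (at a)" if "a \<in> {0, T}" for a
  proof -
    obtain N3 where N3: "(N2 has_real_derivative N3) (at a)"
      using N(3)[of a] by (auto simp: real_differentiable_def)
    have D1: "(D1 has_real_derivative 1) (at a)" using D(2)[of a] D(3)[OF that] by simp
    note q = quotient_limits[OF N(1,2) N3 _ _ _ D(1) D1]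
    show "((\<lambda>x. N x / D x) \<longlongrightarrow> 0) (at a)" "\<exists>L. (r \<longlongrightarrow> L) (at a)"
      unfolding r_def using q N(4)[OF that] D(3)[OF that] by auto
  qed
  obtain l0 lT where l: "(r \<longlongrightarrow> l0) (at 0)" "(r \<longlongrightarrow> lT) (at T)"
    using lim(2) by blast
  have deriv: "((\<lambda>x. N x / D x) has_real_derivative r x) (at x)" if "0 < x" "x < T" for x
    unfolding r_def
    by (rule DERIV_cong[OF DERIV_divide[OF N(1) D(1) nz[OF that]]]) (simp add: power2_eq_square)
  have c: "isCont N x" "isCont N1 x" "isCont D x" "isCont D1 x" for x
    using N(1,2) D(1,2) DERIV_isCont by blast+
  have cr: "isCont r x" if "0 < x" "x < T" for x
    unfolding r_def using c nz[OF that] by (intro continuous_intros) auto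
  have "continuous_on {0..T} (\<lambda>x. if x = 0 then 0 else if x = T then 0 else N x / D x)"
    by (rule continuous_extension_Icc[OF assms(1)])
      (use lim(1) c nz in \<open>auto intro!: continuous_intros\<close>)
  \<comment> \<open>At the ends division by zero yields 0, which is also the limit, so the quotient
    is already its own continuous extension.\<close>
  then have "continuous_on {0..T} (\<lambda>x. N x / D x)"
    by (rule continuous_on_eq) (use N(4) in auto)
  \<comment> \<open>Here the end values must be replaced: division by zero makes r equal to 0 there,
    whatever its limit.\<close>
  moreover have "continuous_on {0..T} (\<lambda>x. if x = 0 then l0 else if x = T then lT else r x)"
    by (rule continuous_extension_Icc[OF assms(1) cr l])
  ultimately show ?thesis
    using deriv N(4)
    by (intro exI[of _ "\<lambda>x. if x = 0 then l0 else if x = T then lT else r x"])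
      (auto simp: C1_vanishing_def)
qed

text \<open>Because p vanishes at 0, it is exactly the antiderivative that \<open>antideriv\<close>
  selects.\<close>

lemma C1_vanishing_integral:
  assumes "C1_vanishing T p p'" "0 \<le> x" "x \<le> T"
  shows "(p' has_integral p x) {0..x}"
proof -
  have "(p' has_integral (p x - p 0)) {0..x}"
  proof (rule fundamental_theorem_of_calculus_interior)
    show "continuous_on {0..x} p"
      using assms by (auto simp: C1_vanishing_def intro: continuous_on_subset)
  qed (use assms in \<open>auto simp: C1_vanishing_def simp flip: has_real_derivative_iff_has_vector_derivative\<close>)
  then show ?thesis using assms by (simp add: C1_vanishing_def)
qed

lemma integral_cluster_agd:
  assumes T: "0 \<le> T"
    and pu: "C1_vanishing T pu pu'" and pv: "C1_vanishing T pv pv'"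
    and qu: "C1_vanishing T qu qu'" and qv: "C1_vanishing T qv qv'"
  shows "\<exists>I. ((\<lambda>x. 2 * pu x * pv' x + 2 * qu x * qv' x - pu x * qv' x - qu x * pv' x) has_integral I) {0..T}
    \<and> ((\<lambda>x. 2 * (pu' x * pv x - pv' x * pu x + qu' x * qv x - qv' x * qu x
          + qu x * pv' x - qv x * pu' x)) has_integral (-2 * I)) {0..T}"
proof -
  let ?R = "\<lambda>x. 2 * pu x * pv' x + 2 * qu x * qv' x - pu x * qv' x - qu x * pv' x"
  note c = pu[unfolded C1_vanishing_def] pv[unfolded C1_vanishing_def]
    qu[unfolded C1_vanishing_def] qv[unfolded C1_vanishing_def]
  have "?R integrable_on {0..T}"
    using c by (intro integrable_continuous_interval continuous_intros) auto
  then obtain I where I: "(?R has_integral I) {0..T}" by blast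
  text \<open>The cluster density plus twice the AGD density is the derivative of \<open>?E\<close>.\<close>
  let ?E = "\<lambda>x. 2 * (pu x * pv x + qu x * qv x - pu x * qv x)"
  let ?E' = "\<lambda>x. 2 * (pu' x * pv x + pu x * pv' x + (qu' x * qv x + qu x * qv' x) - (pu' x * qv x + pu x * qv' x))"
  have "(?E' has_integral (?E T - ?E 0)) {0..T}"
  proof (rule fundamental_theorem_of_calculus_interior[OF T])
    show "continuous_on {0..T} ?E"
      using c by (intro continuous_intros) auto
    show "(?E has_vector_derivative ?E' x) (at x)" if "x \<in> {0<..<T}" for x
    proof -
      have d: "(pu has_real_derivative pu' x) (at x)" "(pv has_real_derivative pv' x) (at x)"
        "(qu has_real_derivative qu' x) (at x)" "(qv has_real_derivative qv' x) (at x)"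
        using c that by auto
      show ?thesis
        unfolding has_real_derivative_iff_has_vector_derivative[symmetric]
        by (rule derivative_eq_intros d refl)+ (simp add: algebra_simps)
    qed
  qed
  then have "(?E' has_integral 0) {0..T}" using c by simp
  from has_integral_diff[OF this has_integral_mult_right[OF I, of 2]]
  have "((\<lambda>x. ?E' x - 2 * ?R x) has_integral (-2 * I)) {0..T}" by simp
  then show ?thesis
    using I by (intro exI[of _ I] conjI) (simp_all add: algebra_simps)
qed

section \<open>Logarithmic variations\<close>

definition frieze_var :: "(real \<Rightarrow> real^3) \<Rightarrow> (real \<Rightarrow> real^3) \<Rightarrow> real \<Rightarrow> real \<Rightarrow> real" where
  "frieze_var \<Gamma> u x y = det3 (u x) (\<Gamma> y) (vderiv 1 \<Gamma> y) + det3 (\<Gamma> x) (u y) (vderiv 1 \<Gamma> y)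
     + det3 (\<Gamma> x) (\<Gamma> y) (vderiv 1 u y)"

text \<open>
  Where \<open>F = 0\<close> the value is \<open>0\<close>, by division by zero. At \<open>(0, 0)\<close>, \<open>(T, 0)\<close> and \<open>(0, T)\<close> this is the
  limit along the axes whenever \<open>u\<close> is a tangent field, so no separate continuous extension is needed.
\<close>

definition log_var :: "(real \<Rightarrow> real^3) \<Rightarrow> (real \<Rightarrow> real^3) \<Rightarrow> real \<Rightarrow> real \<Rightarrow> real" where
  "log_var \<Gamma> u x y = frieze_var \<Gamma> u x y / frieze_F \<Gamma> x y"

lemma variation_frieze:
  assumes "smooth_curve \<Gamma>" "smooth_curve u"
  shows "variation (\<lambda>\<Gamma>. frieze_F \<Gamma> x y) \<Gamma> u = frieze_var \<Gamma> u x y"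
    and "variation (\<lambda>\<Gamma>. frieze_G \<Gamma> x y) \<Gamma> u = frieze_var \<Gamma> u y x"
proof -
  have d: "((\<lambda>t. a + t *\<^sub>R b) has_vector_derivative b) (at 0)" for a b :: "real^3"
    by (auto intro!: derivative_eq_intros)
  show *: "variation (\<lambda>\<Gamma>. frieze_F \<Gamma> x y) \<Gamma> u = frieze_var \<Gamma> u x y" for x y
    unfolding variation_def frieze_F_def vderiv_deform[OF assms]
    by (rule DERIV_imp_deriv, rule DERIV_cong[OF has_real_derivative_det3[OF d d d]])
      (simp add: frieze_var_def)
  show "variation (\<lambda>\<Gamma>. frieze_G \<Gamma> x y) \<Gamma> u = frieze_var \<Gamma> u y x"
    unfolding frieze_G_def by (rule *)
qed

text \<open>Every term of the cluster form is a wedge of two logarithmic differentials, and G is F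
  with its arguments exchanged. The identity persists at zeros of F, where both sides use the same
  convention for division by zero.\<close>

lemma cluster_substituted_log_var:
  assumes "smooth_curve \<Gamma>" "smooth_curve u" "smooth_curve v"
  shows "cluster_substituted \<Gamma> u v x y \<epsilon> =
    log_var \<Gamma> u (x + \<epsilon>) (y - \<epsilon>) * log_var \<Gamma> v (x - \<epsilon>) (y - \<epsilon>)
    - log_var \<Gamma> v (x + \<epsilon>) (y - \<epsilon>) * log_var \<Gamma> u (x - \<epsilon>) (y - \<epsilon>)
    + (log_var \<Gamma> u y (x + 2 * \<epsilon>) * log_var \<Gamma> v y x - log_var \<Gamma> v y (x + 2 * \<epsilon>) * log_var \<Gamma> u y x)
    + (log_var \<Gamma> u (x - \<epsilon>) (y - \<epsilon>) * log_var \<Gamma> v y x - log_var \<Gamma> v (x - \<epsilon>) (y - \<epsilon>) * log_var \<Gamma> u y x)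
    + (log_var \<Gamma> u y x * log_var \<Gamma> v (x + \<epsilon>) (y - \<epsilon>) - log_var \<Gamma> v y x * log_var \<Gamma> u (x + \<epsilon>) (y - \<epsilon>))"
  unfolding cluster_substituted_def cluster_summand_def wedge_def log_var_def
    variation_frieze[OF assms(1,2)] variation_frieze[OF assms(1,3)]
  by (simp add: diff_divide_distrib frieze_G_def mult.commute)

lemma curve_poly_frieze_var:
  assumes "smooth_curve \<Gamma>" "smooth_curve u"
  shows "curve_poly (frieze_var \<Gamma> u)"
proof -
  have *: "curve_poly (\<lambda>x y. c x $ i)" "curve_poly (\<lambda>x y. c y $ i)" if "smooth_curve c" for c i
    using curve_poly.fst[OF that, of 0] curve_poly.snd[OF that, of 0] by simp_all
  then show ?thesis
    unfolding frieze_var_def det3_expand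
    by (intro curve_poly.add curve_poly.diff curve_poly.mult curve_poly.snd * assms)
qed

text \<open>A and B are the two partial derivatives. A single pair serves all directions, which the
  substitution needs since it moves x and y simultaneously.\<close>

lemma log_var_directional:
  assumes "smooth_curve \<Gamma>" "smooth_curve u" "frieze_F \<Gamma> x y \<noteq> 0"
  obtains A B where "\<And>a b. ((\<lambda>\<epsilon>. log_var \<Gamma> u (x + a * \<epsilon>) (y + b * \<epsilon>)) has_real_derivative a * A + b * B) (at 0)"
proof -
  have d: "((\<lambda>\<epsilon>. f (x + a * \<epsilon>) (y + b * \<epsilon>)) has_real_derivative a * g x y + b * h x y) (at 0)"
    if "partials f g h" for f g h a b
  proof -
    have "((\<lambda>\<epsilon>. (x + a * \<epsilon>, y + b * \<epsilon>)) has_derivative (\<lambda>\<epsilon>. (a * \<epsilon>, b * \<epsilon>))) (at 0)"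
      by (auto intro!: derivative_eq_intros)
    from has_derivative_compose[OF this that[unfolded partials_def, rule_format], unfolded fst_conv snd_conv]
    show ?thesis
      unfolding has_field_derivative_def
      by (rule has_derivative_eq_rhs) (simp add: fun_eq_iff algebra_simps)
  qed
  obtain g h k l where "partials (frieze_var \<Gamma> u) g h" "partials (frieze_F \<Gamma>) k l"
    using curve_poly_partials curve_poly_frieze_var[OF assms(1,2)] curve_poly_frieze_F[OF assms(1)] by meson
  note n = d[OF this(1)] and e = d[OF this(2)]
  define A where "A = (g x y * frieze_F \<Gamma> x y - frieze_var \<Gamma> u x y * k x y) / (frieze_F \<Gamma> x y)\<^sup>2"
  define B where "B = (h x y * frieze_F \<Gamma> x y - frieze_var \<Gamma> u x y * l x y) / (frieze_F \<Gamma> x y)\<^sup>2"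
  have "((\<lambda>\<epsilon>. log_var \<Gamma> u (x + a * \<epsilon>) (y + b * \<epsilon>)) has_real_derivative a * A + b * B) (at 0)" for a b
    unfolding log_var_def
    by (rule DERIV_cong[OF DERIV_divide[OF n e]])
      (use assms(3) in \<open>auto simp: A_def B_def power2_eq_square field_simps\<close>)
  then show ?thesis using that by blast
qed

text \<open>Both F-entries move with the same y - \<epsilon>, so the y-derivatives \<open>Bu\<close>
  and \<open>Bv\<close> cancel. Opposite motions in x, and the step 2 \<epsilon> in G, produce the
  common factor 2.\<close>

lemma cluster_density_log_var:
  assumes smooth: "smooth_curve \<Gamma>" "smooth_curve u" "smooth_curve v"
    and nz: "frieze_F \<Gamma> x y \<noteq> 0" "frieze_F \<Gamma> y x \<noteq> 0"
    and p: "((\<lambda>x. log_var \<Gamma> u x y) has_real_derivative pu') (at x)"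
      "((\<lambda>x. log_var \<Gamma> v x y) has_real_derivative pv') (at x)"
    and q: "((\<lambda>x. log_var \<Gamma> u y x) has_real_derivative qu') (at x)"
      "((\<lambda>x. log_var \<Gamma> v y x) has_real_derivative qv') (at x)"
  shows "((\<lambda>\<epsilon>. cluster_substituted \<Gamma> u v x y \<epsilon>) has_real_derivative
    2 * (pu' * log_var \<Gamma> v x y - pv' * log_var \<Gamma> u x y + qu' * log_var \<Gamma> v y x - qv' * log_var \<Gamma> u y x
      + log_var \<Gamma> u y x * pv' - log_var \<Gamma> v y x * pu')) (at 0)"
proof -
  have main: "\<exists>B. ((\<lambda>\<epsilon>. log_var \<Gamma> w (x + \<epsilon>) (y - \<epsilon>)) has_real_derivative p' - B) (at 0)
      \<and> ((\<lambda>\<epsilon>. log_var \<Gamma> w (x - \<epsilon>) (y - \<epsilon>)) has_real_derivative - p' - B) (at 0)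
      \<and> ((\<lambda>\<epsilon>. log_var \<Gamma> w y (x + 2 * \<epsilon>)) has_real_derivative 2 * q') (at 0)"
    if w: "smooth_curve w" and p: "((\<lambda>x. log_var \<Gamma> w x y) has_real_derivative p') (at x)"
      and q: "((\<lambda>x. log_var \<Gamma> w y x) has_real_derivative q') (at x)" for w p' q'
  proof -
    obtain A B where AB: "\<And>a b. ((\<lambda>\<epsilon>. log_var \<Gamma> w (x + a * \<epsilon>) (y + b * \<epsilon>)) has_real_derivative a * A + b * B) (at 0)"
      using log_var_directional[OF smooth(1) w nz(1)] by metis
    \<comment> \<open>Uniqueness of the derivative in direction (1, 0) identifies A with the given
      p'; B remains unspecified.\<close>
    have "((\<lambda>\<epsilon>. log_var \<Gamma> w (\<epsilon> + x) y) has_real_derivative p') (at 0)"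
      using p DERIV_shift[of "\<lambda>x. log_var \<Gamma> w x y" p' 0 x] by simp
    with AB[of 1 0] have "A = p'"
      using DERIV_unique by (simp add: add.commute) blast
    moreover have "((\<lambda>\<epsilon>. log_var \<Gamma> w y (x + 2 * \<epsilon>)) has_real_derivative q' * 2) (at 0)"
      by (rule DERIV_chain2[where f = "\<lambda>x. log_var \<Gamma> w y x" and g = "\<lambda>\<epsilon>. x + 2 * \<epsilon>"])
        (use q in \<open>auto intro!: derivative_eq_intros\<close>)
    ultimately show ?thesis
      using AB[of 1 "-1"] AB[of "-1" "-1"] by (auto simp: mult.commute)
  qed
  obtain Bu Bv where *:
    "((\<lambda>\<epsilon>. log_var \<Gamma> u (x + \<epsilon>) (y - \<epsilon>)) has_real_derivative pu' - Bu) (at 0)"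
    "((\<lambda>\<epsilon>. log_var \<Gamma> u (x - \<epsilon>) (y - \<epsilon>)) has_real_derivative - pu' - Bu) (at 0)"
    "((\<lambda>\<epsilon>. log_var \<Gamma> u y (x + 2 * \<epsilon>)) has_real_derivative 2 * qu') (at 0)"
    "((\<lambda>\<epsilon>. log_var \<Gamma> v (x + \<epsilon>) (y - \<epsilon>)) has_real_derivative pv' - Bv) (at 0)"
    "((\<lambda>\<epsilon>. log_var \<Gamma> v (x - \<epsilon>) (y - \<epsilon>)) has_real_derivative - pv' - Bv) (at 0)"
    "((\<lambda>\<epsilon>. log_var \<Gamma> v y (x + 2 * \<epsilon>)) has_real_derivative 2 * qv') (at 0)"
    using main[OF smooth(2) p(1) q(1)] main[OF smooth(3) p(2) q(2)] by blast
  show ?thesis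
    unfolding cluster_substituted_log_var[OF smooth]
    by (rule derivative_eq_intros * refl)+ (simp add: algebra_simps)
qed

section \<open>The Wronskian and the variations of \<open>a1\<close> and \<open>a2\<close>\<close>

text \<open>The polarised Wronskian of the first two components, with its first two derivatives.\<close>

definition wr :: "(real \<Rightarrow> real^3) \<Rightarrow> (real \<Rightarrow> real^3) \<Rightarrow> real \<Rightarrow> real" where
  "wr f g x = f x $ 1 * vderiv 1 g x $ 2 - vderiv 1 f x $ 1 * g x $ 2"

definition wr1 :: "(real \<Rightarrow> real^3) \<Rightarrow> (real \<Rightarrow> real^3) \<Rightarrow> real \<Rightarrow> real" where
  "wr1 f g x = f x $ 1 * vderiv 2 g x $ 2 - vderiv 2 f x $ 1 * g x $ 2"

definition wr2 :: "(real \<Rightarrow> real^3) \<Rightarrow> (real \<Rightarrow> real^3) \<Rightarrow> real \<Rightarrow> real" where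
  "wr2 f g x = vderiv 1 f x $ 1 * vderiv 2 g x $ 2 + f x $ 1 * vderiv 3 g x $ 2
     - vderiv 3 f x $ 1 * g x $ 2 - vderiv 2 f x $ 1 * vderiv 1 g x $ 2"

lemma has_real_derivative_wr:
  assumes "smooth_curve f" "smooth_curve g"
  shows "(wr f g has_real_derivative wr1 f g x) (at x)"
    and "(wr1 f g has_real_derivative wr2 f g x) (at x)"
    and "wr2 f g differentiable (at x)"
proof -
  note d = has_real_derivative_vderiv[OF assms(1)] has_real_derivative_vderiv[OF assms(2)]
  note d0 = d[of 0, unfolded vderiv_0 One_nat_def[symmetric]]
    and d1 = d[of 1, unfolded Suc_1]
  have d2: "((\<lambda>x. vderiv 2 f x $ i) has_real_derivative vderiv 3 f x $ i) (at x)"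
    "((\<lambda>x. vderiv 2 g x $ i) has_real_derivative vderiv 3 g x $ i) (at x)" for i
    using d[of 2 i x UNIV] by (simp_all add: eval_nat_numeral)
  show "(wr f g has_real_derivative wr1 f g x) (at x)"
    unfolding wr_def by (rule derivative_eq_intros d0 d1 refl)+ (simp add: wr1_def algebra_simps)
  show "(wr1 f g has_real_derivative wr2 f g x) (at x)"
    unfolding wr1_def by (rule derivative_eq_intros d0 d2 refl)+ (simp add: wr2_def algebra_simps)
  have "(\<lambda>x. vderiv n f x $ i) differentiable (at x)" "(\<lambda>x. vderiv n g x $ i) differentiable (at x)" for n i
    using d[of n i x UNIV] by (auto simp: real_differentiable_def)
  note D = this this[of 0, unfolded vderiv_0]
  show "wr2 f g differentiable (at x)"
    unfolding wr2_def by (intro derivative_intros D)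
qed

text \<open>The Wronskian is quadratic in the curve. The coefficient of t is its variation, and the
  t^2 term disappears on differentiating at t = 0.\<close>

lemma wronskian_deform:
  assumes "smooth_curve \<Gamma>" "smooth_curve u"
  shows "wronskian (\<lambda>s. \<Gamma> s + t *\<^sub>R u s) =
    (\<lambda>x. wr \<Gamma> \<Gamma> x + t * (wr \<Gamma> u x + wr u \<Gamma> x) + t\<^sup>2 * wr u u x)"
  unfolding wronskian_def deriv_nth[OF smooth_curve_deform[OF assms]] vderiv_deform[OF assms] wr_def
  by (simp add: fun_eq_iff algebra_simps power2_eq_square)

text \<open>\<open>a1\<close> is minus the x-derivative of log y1, and variation commutes with d/dx;
  the two quotient rules confirm this.\<close>

lemma variation_a1:
  assumes smooth: "smooth_curve \<Gamma>" "smooth_curve u" and nz: "\<Gamma> x $ 1 \<noteq> 0"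
    and p: "((\<lambda>x. u x $ 1 / \<Gamma> x $ 1) has_real_derivative p') (at x)"
  shows "variation (\<lambda>\<Gamma>. a1 \<Gamma> x) \<Gamma> u = - p'"
proof -
  have "p' = (vderiv 1 u x $ 1 * \<Gamma> x $ 1 - u x $ 1 * vderiv 1 \<Gamma> x $ 1) / (\<Gamma> x $ 1 * \<Gamma> x $ 1)"
    by (rule DERIV_unique[OF p DERIV_divide[OF has_real_derivative_nth[OF smooth(2)]
          has_real_derivative_nth[OF smooth(1)] nz]])
  moreover have "((\<lambda>t. - (vderiv 1 \<Gamma> x $ 1 + t * vderiv 1 u x $ 1) / (\<Gamma> x $ 1 + t * u x $ 1)) has_real_derivative
      - ((vderiv 1 u x $ 1 * \<Gamma> x $ 1 - u x $ 1 * vderiv 1 \<Gamma> x $ 1) / (\<Gamma> x $ 1 * \<Gamma> x $ 1))) (at 0)"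
    using nz by (auto intro!: derivative_eq_intros simp: divide_simps)
  ultimately show ?thesis
    unfolding variation_def a1_def deriv_nth[OF smooth_curve_deform[OF smooth]] vderiv_deform[OF smooth]
    by (simp add: DERIV_imp_deriv)
qed

text \<open>The same commutation, since \<open>a2\<close> is the logarithmic derivative of y1 minus
  that of W.\<close>

lemma variation_a2:
  assumes smooth: "smooth_curve \<Gamma>" "smooth_curve u" and nz: "\<Gamma> x $ 1 \<noteq> 0" "wr \<Gamma> \<Gamma> x \<noteq> 0"
    and p: "((\<lambda>x. u x $ 1 / \<Gamma> x $ 1) has_real_derivative p') (at x)"
    and q: "((\<lambda>x. (wr \<Gamma> u x + wr u \<Gamma> x) / wr \<Gamma> \<Gamma> x) has_real_derivative q') (at x)"
  shows "variation (\<lambda>\<Gamma>. a2 \<Gamma> x) \<Gamma> u = p' - q'"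
proof -
  let ?V = "wr \<Gamma> u x + wr u \<Gamma> x" and ?V' = "wr1 \<Gamma> u x + wr1 u \<Gamma> x"
  note W' = has_real_derivative_wr(1)
  have p': "p' = (vderiv 1 u x $ 1 * \<Gamma> x $ 1 - u x $ 1 * vderiv 1 \<Gamma> x $ 1) / (\<Gamma> x $ 1 * \<Gamma> x $ 1)"
    by (rule DERIV_unique[OF p DERIV_divide[OF has_real_derivative_nth[OF smooth(2)]
          has_real_derivative_nth[OF smooth(1)] nz(1)]])
  have q': "q' = (?V' * wr \<Gamma> \<Gamma> x - ?V * wr1 \<Gamma> \<Gamma> x) / (wr \<Gamma> \<Gamma> x * wr \<Gamma> \<Gamma> x)"
    by (rule DERIV_unique[OF q DERIV_divide[OF DERIV_add[OF W'[OF smooth] W'[OF smooth(2,1)]]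
            W'[OF smooth(1,1)] nz(2)]])
  have W: "deriv (wronskian (\<lambda>s. \<Gamma> s + t *\<^sub>R u s)) x = wr1 \<Gamma> \<Gamma> x + t * ?V' + t\<^sup>2 * wr1 u u x" for t
    unfolding wronskian_deform[OF smooth]
    by (rule DERIV_imp_deriv) (auto intro!: derivative_eq_intros W' smooth)
  have "((\<lambda>t. (vderiv 1 \<Gamma> x $ 1 + t * vderiv 1 u x $ 1) / (\<Gamma> x $ 1 + t * u x $ 1)) has_real_derivative p') (at 0)"
    using nz by (auto intro!: derivative_eq_intros simp: divide_simps p')
  moreover have "((\<lambda>t. (wr1 \<Gamma> \<Gamma> x + t * ?V' + t\<^sup>2 * wr1 u u x) / (wr \<Gamma> \<Gamma> x + t * ?V + t\<^sup>2 * wr u u x))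
      has_real_derivative q') (at 0)"
    using nz by (auto intro!: derivative_eq_intros simp: q' divide_simps) 
  ultimately have "((\<lambda>t. (vderiv 1 \<Gamma> x $ 1 + t * vderiv 1 u x $ 1) / (\<Gamma> x $ 1 + t * u x $ 1)
      - (wr1 \<Gamma> \<Gamma> x + t * ?V' + t\<^sup>2 * wr1 u u x) / (wr \<Gamma> \<Gamma> x + t * ?V + t\<^sup>2 * wr u u x))
      has_real_derivative (p' - q')) (at 0)"
    by (rule DERIV_diff)
  then show ?thesis
    unfolding variation_def a2_def W
    unfolding deriv_nth[OF smooth_curve_deform[OF smooth]] vderiv_deform[OF smooth]
      wronskian_deform[OF smooth]
    by (simp add: DERIV_imp_deriv)
qed

section \<open>Comparison of the two forms at a normalised convex lift\<close>

locale normalized_convex_lift =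
  fixes T :: real and \<Gamma> :: "real \<Rightarrow> real^3"
  assumes lift: "closed_convex_lift T \<Gamma>" and normalized: "normalized_lift \<Gamma>"
begin

lemma T_pos: "0 < T" and smooth: "smooth_curve \<Gamma>" and periodic: "\<Gamma> (x + T) = \<Gamma> x"
  using lift by (auto simp: closed_convex_lift_def)

lemma jet_0 [simp]: "\<Gamma> 0 = vector [0, 0, 1]" "vderiv 1 \<Gamma> 0 = vector [0, -1, 0]" "vderiv (Suc 0) \<Gamma> 0 = vector [0, -1, 0]"
    "vderiv 2 \<Gamma> 0 = vector [1, 0, 0]"
  using normalized by (auto simp: normalized_lift_def)

lemma vderiv_T:
  assumes "a \<in> {0, T}"
  shows "vderiv n \<Gamma> a = vderiv n \<Gamma> 0"
  using assms vderiv_periodic[of \<Gamma> T n 0] smooth periodic by auto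

lemma frieze_F_x0: "frieze_F \<Gamma> x 0 = \<Gamma> x $ 1"
  by (simp add: frieze_F_def det3_expand vector_3)

lemma frieze_F_0x: "frieze_F \<Gamma> 0 x = wr \<Gamma> \<Gamma> x"
  by (simp add: frieze_F_def wr_def det3_expand vector_3 algebra_simps)

lemma nonzero:
  assumes "0 < x" "x < T"
  shows "\<Gamma> x $ 1 \<noteq> 0" "wr \<Gamma> \<Gamma> x \<noteq> 0"
proof -
  show "\<Gamma> x $ 1 \<noteq> 0"
    using frieze_F_nonzero[OF lift, of 0 x] assms by (simp add: frieze_F_x0)
  \<comment> \<open>W x is F(0, x), but 0 lies to the left of x. Its periodic copy T lies strictly
    between x and x + T, where the tangent line at x is not met again.\<close>
  have "frieze_F \<Gamma> T x \<noteq> 0"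
    using frieze_F_nonzero[OF lift, of x T] assms by simp
  then show "wr \<Gamma> \<Gamma> x \<noteq> 0"
    using periodic[of 0] by (simp add: frieze_F_def flip: frieze_F_0x)
qed

context
  fixes u :: "real \<Rightarrow> real^3"
  assumes tangent: "tangent_field T u"
begin

lemma u_smooth: "smooth_curve u" and u_jet_0: "u 0 = 0" "vderiv 1 u 0 = 0" "vderiv 2 u 0 = 0"
  using tangent by (auto simp: tangent_field_def)

lemma u_jet_ends:
  assumes "a \<in> {0, T}"
  shows "u a = 0" "vderiv 1 u a = 0" "vderiv 2 u a = 0"
proof -
  have "vderiv n u a = vderiv n u 0" for n
    using assms vderiv_periodic[of u T n 0] tangent by (auto simp: tangent_field_def)
  from this[of 0] this[of 1] this[of 2] show "u a = 0" "vderiv 1 u a = 0" "vderiv 2 u a = 0"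
    using u_jet_0 by simp_all
qed

lemma log_var_x0: "log_var \<Gamma> u x 0 = u x $ 1 / \<Gamma> x $ 1"
  using u_jet_0 by (simp add: log_var_def frieze_F_x0 frieze_var_def det3_expand vector_3)

lemma log_var_0x: "log_var \<Gamma> u 0 x = (wr \<Gamma> u x + wr u \<Gamma> x) / wr \<Gamma> \<Gamma> x"
  using u_jet_0 by (simp add: log_var_def frieze_F_0x frieze_var_def wr_def det3_expand vector_3 algebra_simps)

text \<open>At both ends y1 and W have value 0, first derivative 0 and second derivative 1, while
  the 2-jets of their variations vanish.\<close>

lemma log_var_C1_vanishing:
  "\<exists>p'. C1_vanishing T (\<lambda>x. log_var \<Gamma> u x 0) p'" "\<exists>q'. C1_vanishing T (\<lambda>x. log_var \<Gamma> u 0 x) q'"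
proof -
  have 2: "Suc 1 = 2" by simp
  note d = has_real_derivative_nth[OF u_smooth] has_real_derivative_vderiv[OF u_smooth, of 1, unfolded 2]
    has_real_derivative_nth[OF smooth] has_real_derivative_vderiv[OF smooth, of 1, unfolded 2]
  have jet: "\<Gamma> a = vector [0, 0, 1]" "vderiv 1 \<Gamma> a = vector [0, -1, 0]" "vderiv 2 \<Gamma> a = vector [1, 0, 0]"
    if "a \<in> {0, T}" for a
    using vderiv_T[OF that, of 0] vderiv_T[OF that, of 1] vderiv_T[OF that, of 2] by simp_all
  show "\<exists>p'. C1_vanishing T (\<lambda>x. log_var \<Gamma> u x 0) p'"
    unfolding log_var_x0
  proof (rule quotient_C1_vanishing[OF T_pos d(1,2) _ _ d(3,4)])
    show "(\<lambda>x. vderiv 2 u x $ 1) differentiable (at x)" for x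
      using has_real_derivative_vderiv[OF u_smooth, of 2 1 x UNIV] by (auto simp: real_differentiable_def)
  qed (use nonzero u_jet_ends jet in \<open>simp_all add: vector_3\<close>)
  note w = has_real_derivative_wr[OF smooth u_smooth] has_real_derivative_wr[OF u_smooth smooth]
    has_real_derivative_wr[OF smooth smooth]
  show "\<exists>q'. C1_vanishing T (\<lambda>x. log_var \<Gamma> u 0 x) q'"
    unfolding log_var_0x
  proof (rule quotient_C1_vanishing[OF T_pos DERIV_add[OF w(1,4)] DERIV_add[OF w(2,5)]
        differentiable_add[OF w(3,6)] _ w(7,8)])
    \<comment> \<open>Third derivatives of u are not controlled at the ends, but they occur
      multiplied by one of the first two components of \<Gamma>, which vanish there. The entry -1 in
      the normalisation makes the second derivative of W equal to +1.\<close>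
    show "wr \<Gamma> u a + wr u \<Gamma> a = 0 \<and> wr1 \<Gamma> u a + wr1 u \<Gamma> a = 0 \<and> wr2 \<Gamma> u a + wr2 u \<Gamma> a = 0"
      "wr \<Gamma> \<Gamma> a = 0 \<and> wr1 \<Gamma> \<Gamma> a = 0 \<and> wr2 \<Gamma> \<Gamma> a = 1" if "a \<in> {0, T}" for a
      unfolding wr_def wr1_def wr2_def u_jet_ends[OF that] jet[OF that] by (simp_all add: vector_3)
  qed (use nonzero in simp_all)
qed

lemma variation_a1_a2:
  assumes "C1_vanishing T (\<lambda>x. log_var \<Gamma> u x 0) p'" "C1_vanishing T (\<lambda>x. log_var \<Gamma> u 0 x) q'" "x \<in> {0<..<T}"
  shows "variation (\<lambda>\<Gamma>. a1 \<Gamma> x) \<Gamma> u = - p' x" "variation (\<lambda>\<Gamma>. a2 \<Gamma> x) \<Gamma> u = p' x - q' x"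
  using assms nonzero[of x] variation_a1[OF smooth u_smooth] variation_a2[OF smooth u_smooth]
  unfolding C1_vanishing_def log_var_x0 log_var_0x by simp_all

text \<open>The formulas for the variations hold inside the period, and the two end points do not
  affect the integral. Besides d^{-1} this gives the zero means, by taking x = T.\<close>

lemma antideriv_a1_a2:
  assumes p: "C1_vanishing T (\<lambda>x. log_var \<Gamma> u x 0) p'" and q: "C1_vanishing T (\<lambda>x. log_var \<Gamma> u 0 x) q'"
    and x: "0 \<le> x" "x \<le> T"
  shows "((\<lambda>x. variation (\<lambda>\<Gamma>. a1 \<Gamma> x) \<Gamma> u) has_integral - log_var \<Gamma> u x 0) {0..x}"
    "((\<lambda>x. variation (\<lambda>\<Gamma>. a2 \<Gamma> x) \<Gamma> u) has_integral log_var \<Gamma> u x 0 - log_var \<Gamma> u 0 x) {0..x}"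
proof -
  have spike: "(g has_integral i) {0..x}" if "(f has_integral i) {0..x}" "\<And>y. y \<in> {0<..<T} \<Longrightarrow> g y = f y"
    for f g :: "real \<Rightarrow> real" and i
    using has_integral_spike_interior[of f i 0 x g] that x by (auto simp: box_real)
  note i = C1_vanishing_integral[OF p x] C1_vanishing_integral[OF q x]
  show "((\<lambda>x. variation (\<lambda>\<Gamma>. a1 \<Gamma> x) \<Gamma> u) has_integral - log_var \<Gamma> u x 0) {0..x}"
    by (rule spike[OF has_integral_neg[OF i(1)]]) (rule variation_a1_a2[OF p q])
  show "((\<lambda>x. variation (\<lambda>\<Gamma>. a2 \<Gamma> x) \<Gamma> u) has_integral log_var \<Gamma> u x 0 - log_var \<Gamma> u 0 x) {0..x}"
    by (rule spike[OF has_integral_diff[OF i]]) (rule variation_a1_a2[OF p q])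
qed

end

lemma agd_density_log_var:
  assumes u: "tangent_field T u" and v: "tangent_field T v" and x: "x \<in> {0<..<T}"
    and pu: "C1_vanishing T (\<lambda>x. log_var \<Gamma> u x 0) pu'" and qu: "C1_vanishing T (\<lambda>x. log_var \<Gamma> u 0 x) qu'"
    and pv: "C1_vanishing T (\<lambda>x. log_var \<Gamma> v x 0) pv'" and qv: "C1_vanishing T (\<lambda>x. log_var \<Gamma> v 0 x) qv'"
  shows "agd_density \<Gamma> u v x = 2 * log_var \<Gamma> u x 0 * pv' x + 2 * log_var \<Gamma> u 0 x * qv' x
    - log_var \<Gamma> u x 0 * qv' x - log_var \<Gamma> u 0 x * pv' x"
proof -
  have a: "antideriv (\<lambda>s. variation (\<lambda>\<Gamma>. a1 \<Gamma> s) \<Gamma> u) x = - log_var \<Gamma> u x 0"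
    "antideriv (\<lambda>s. variation (\<lambda>\<Gamma>. a2 \<Gamma> s) \<Gamma> u) x = log_var \<Gamma> u x 0 - log_var \<Gamma> u 0 x"
    using antideriv_a1_a2[OF u pu qu, of x] x by (auto simp: antideriv_def integral_unique)
  show ?thesis
    unfolding agd_density_def a variation_a1_a2[OF v pv qv x]
    by (simp add: inner_vec_def sum_2 matrix_vector_mult_def vector_2 algebra_simps)
qed

lemma cluster_limit_agd:
  assumes u: "tangent_field T u" and v: "tangent_field T v"
  shows "\<And>x. x \<in> {0<..<T} \<Longrightarrow> cluster_substituted \<Gamma> u v x 0 0 = 0"
    and "\<And>x. x \<in> {0<..<T} \<Longrightarrow> (\<lambda>\<epsilon>. cluster_substituted \<Gamma> u v x 0 \<epsilon>) differentiable (at 0)"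
    and "(\<lambda>x. cluster_density \<Gamma> u v x 0) integrable_on {0..T}"
    and "((\<lambda>x. variation (\<lambda>\<Gamma>. a1 \<Gamma> x) \<Gamma> u) has_integral 0) {0..T}"
    and "((\<lambda>x. variation (\<lambda>\<Gamma>. a2 \<Gamma> x) \<Gamma> u) has_integral 0) {0..T}"
    and "agd_density \<Gamma> u v integrable_on {0..T}"
    and "cluster_limit T \<Gamma> u v = - 2 * omega_AGD T \<Gamma> u v"
proof -
  obtain pu' qu' pv' qv' where
    pu: "C1_vanishing T (\<lambda>x. log_var \<Gamma> u x 0) pu'" and qu: "C1_vanishing T (\<lambda>x. log_var \<Gamma> u 0 x) qu'" and
    pv: "C1_vanishing T (\<lambda>x. log_var \<Gamma> v x 0) pv'" and qv: "C1_vanishing T (\<lambda>x. log_var \<Gamma> v 0 x) qv'"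
    using log_var_C1_vanishing[OF u] log_var_C1_vanishing[OF v] by blast
  note us = u_smooth[OF u] and vs = u_smooth[OF v]
  let ?C = "\<lambda>x. 2 * (pu' x * log_var \<Gamma> v x 0 - pv' x * log_var \<Gamma> u x 0
    + qu' x * log_var \<Gamma> v 0 x - qv' x * log_var \<Gamma> u 0 x
    + log_var \<Gamma> u 0 x * pv' x - log_var \<Gamma> v 0 x * pu' x)"
  have C: "((\<lambda>\<epsilon>. cluster_substituted \<Gamma> u v x 0 \<epsilon>) has_real_derivative ?C x) (at 0)"
    if "x \<in> {0<..<T}" for x
    by (rule cluster_density_log_var[OF smooth us vs])
      (use pu pv qu qv that nonzero in \<open>auto simp: C1_vanishing_def frieze_F_x0 frieze_F_0x\<close>)
  \<comment> \<open>At \<epsilon> = 0 the first two wedges pair a form with itself, and the last two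
    cancel each other.\<close>
  show "cluster_substituted \<Gamma> u v x 0 0 = 0" for x
    by (simp add: cluster_substituted_log_var[OF smooth us vs])
  show "(\<lambda>\<epsilon>. cluster_substituted \<Gamma> u v x 0 \<epsilon>) differentiable (at 0)" if "x \<in> {0<..<T}" for x
    using C[OF that] real_differentiable_def by blast
  have T: "0 \<le> T" "log_var \<Gamma> u T 0 = 0" "log_var \<Gamma> u 0 T = 0"
    using T_pos pu qu by (auto simp: C1_vanishing_def)
  show "((\<lambda>x. variation (\<lambda>\<Gamma>. a1 \<Gamma> x) \<Gamma> u) has_integral 0) {0..T}"
    "((\<lambda>x. variation (\<lambda>\<Gamma>. a2 \<Gamma> x) \<Gamma> u) has_integral 0) {0..T}"
    using antideriv_a1_a2[OF u pu qu T(1) order_refl] T by simp_all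
  have spike: "(g has_integral i) {0..T}" if "(f has_integral i) {0..T}" "\<And>y. y \<in> {0<..<T} \<Longrightarrow> g y = f y"
    for f g :: "real \<Rightarrow> real" and i
    using has_integral_spike_interior[of f i 0 T g] that by (auto simp: box_real)
  \<comment> \<open>One number I expresses both integrals, which is where the ratio -2 comes
    from.\<close>
  obtain I where I: "((\<lambda>x. 2 * log_var \<Gamma> u x 0 * pv' x + 2 * log_var \<Gamma> u 0 x * qv' x
    - log_var \<Gamma> u x 0 * qv' x - log_var \<Gamma> u 0 x * pv' x) has_integral I) {0..T}"
    "(?C has_integral (- 2 * I)) {0..T}"
    using integral_cluster_agd[OF T(1) pu pv qu qv] by blast
  have agd: "(agd_density \<Gamma> u v has_integral I) {0..T}"
    by (rule spike[OF I(1)]) (rule agd_density_log_var[OF u v _ pu qu pv qv])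
  have cluster: "((\<lambda>x. cluster_density \<Gamma> u v x 0) has_integral (- 2 * I)) {0..T}"
    by (rule spike[OF I(2)]) (unfold cluster_density_def, rule DERIV_imp_deriv[OF C])
  show "agd_density \<Gamma> u v integrable_on {0..T}" "(\<lambda>x. cluster_density \<Gamma> u v x 0) integrable_on {0..T}"
    using agd cluster by blast+
  show "cluster_limit T \<Gamma> u v = - 2 * omega_AGD T \<Gamma> u v"
    unfolding cluster_limit_def omega_AGD_def using agd cluster by (simp add: integral_unique)
qed

end

theorem theorem5p3:
  shows "\<exists>c::real. c \<noteq> 0 \<and>
    (\<forall>T \<Gamma>. closed_convex_lift T \<Gamma> \<and> normalized_lift \<Gamma> \<longrightarrow>
       closed_continuous_2frieze T (frieze_F \<Gamma>) (frieze_G \<Gamma>) \<and>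
       (\<forall>u v. tangent_field T u \<and> tangent_field T v \<longrightarrow>
          (\<forall>x\<in>{0<..<T}. cluster_substituted \<Gamma> u v x 0 0 = 0 \<and>
             (\<lambda>\<epsilon>. cluster_substituted \<Gamma> u v x 0 \<epsilon>) differentiable (at 0)) \<and>
          (\<lambda>x. cluster_density \<Gamma> u v x 0) integrable_on {0..T} \<and>
          ((\<lambda>x. variation (\<lambda>\<Gamma>. a1 \<Gamma> x) \<Gamma> u) has_integral 0) {0..T} \<and>
          ((\<lambda>x. variation (\<lambda>\<Gamma>. a2 \<Gamma> x) \<Gamma> u) has_integral 0) {0..T} \<and>
          agd_density \<Gamma> u v integrable_on {0..T} \<and>
          cluster_limit T \<Gamma> u v = c * omega_AGD T \<Gamma> u v))"
proof (intro exI[of _ "-2"] conjI allI impI ballI)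
  fix T \<Gamma>
  assume "closed_convex_lift T \<Gamma> \<and> normalized_lift \<Gamma>"
  then interpret normalized_convex_lift T \<Gamma> by unfold_locales auto
  show "closed_continuous_2frieze T (frieze_F \<Gamma>) (frieze_G \<Gamma>)"
    using closed_continuous_2frieze_lift[OF smooth periodic] lift by (simp add: closed_convex_lift_def)
  fix u v
  assume "tangent_field T u \<and> tangent_field T v"
  then have "tangent_field T u" "tangent_field T v" by auto
  note limit = cluster_limit_agd[OF this]
  show "cluster_substituted \<Gamma> u v x 0 0 = 0"
    "(\<lambda>\<epsilon>. cluster_substituted \<Gamma> u v x 0 \<epsilon>) differentiable (at 0)" if "x \<in> {0<..<T}" for x
    using limit(1,2) that by blast+
  show "(\<lambda>x. cluster_density \<Gamma> u v x 0) integrable_on {0..T}"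
    "((\<lambda>x. variation (\<lambda>\<Gamma>. a1 \<Gamma> x) \<Gamma> u) has_integral 0) {0..T}"
    "((\<lambda>x. variation (\<lambda>\<Gamma>. a2 \<Gamma> x) \<Gamma> u) has_integral 0) {0..T}"
    "agd_density \<Gamma> u v integrable_on {0..T}"
    "cluster_limit T \<Gamma> u v = -2 * omega_AGD T \<Gamma> u v"
    by (rule limit(3-7))+
qed simp

end
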